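(* Let $u$ be an inner function on the open unit disk with $u(0)\neq0$, and let $\mathscr{S}$ be a closed $D_u$-invariant subspace of $\mathcal{K}_u^{\perp}$. If $D_u\mathscr{S}=\mathscr{S}$, then there is a measurable set $A\subseteq\mathbb{T}$ for which $$\mathscr{S}=\big(P^{-}+u\,\overline{u(0)}\,P^{+}\big)\chi_AL^2.$$ If $D_u\mathscr{S}\neq\mathscr{S}$, then $$\mathscr{S}=\big(P^{-}+u\,\overline{u(0)}\,P^{+}\big)wH^2$$ for some $w\in L^{\infty}$ with $|w|=1$ almost everywhere on $\mathbb{T}$.
   Context: $L^2=L^2(\mathbb{T},dm)$, where $\mathbb{T}$ is the unit circle and $m$ is normalized Lebesgue measure. $H^2=\{f\in L^2:\widehat f(n)=0\ \forall n<0\}$ is the Hardy space and $\overline{H^2_0}=\{\overline{zf}:f\in H^2\}$, so $L^2=H^2\oplus\overline{H^2_0}$; $P^{+}$ and $P^{-}$ are the orthogonal projections of $L^2$ onto $H^2$ and $\overline{H^2_0}$ respectively. For an inner function $u$, $\mathcal{K}_u=H^2\cap(uH^2)^{\perp}$, $P_u$ is the orthogonal projection of $L^2$ onto $\mathcal{K}_u$, and $\mathcal{K}_u^{\perp}$ is the orthogonal complement of $\mathcal{K}_u$ in $L^2$. The dual of the compressed shift is $D_u:\mathcal{K}_u^{\perp}\to\mathcal{K}_u^{\perp}$, $D_uf=(I-P_u)(zf)$. A subspace $\mathscr{S}$ is $D_u$-invariant if $D_u\mathscr{S}\subseteq\mathscr{S}$. The operator $P^{-}+u\,\overline{u(0)}\,P^{+}$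 acts by $g\mapsto P^{-}g+u\,\overline{u(0)}\,P^{+}g$, and applied to a subspace it denotes the image of that subspace; $\chi_A$ is the indicator function of $A$. *)

theory Defs
  imports "HOL-Complex_Analysis.Complex_Analysis" "HOL-Probability.Probability"
begin

section \<open>Normalized Lebesgue measure on the unit circle\<close>

definition circle_measure :: "complex measure" where
  "circle_measure =
     distr (uniform_measure lborel {0..2 * pi}) (restrict_space borel (sphere 0 1)) cis"

lemma cis_measurable_circle:
  "cis \<in> uniform_measure lborel {0..2 * pi} \<rightarrow>\<^sub>M restrict_space borel (sphere 0 1)"
proof (rule measurable_restrict_space2)
  show "cis \<in> uniform_measure lborel {0..2 * pi} \<rightarrow>\<^sub>M borel"
    unfolding measurable_cong_sets[OF sets_uniform_measure refl] measurable_lborel2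
    by (intro borel_measurable_continuous_onI continuous_intros)
qed auto

lemma space_circle_measure [simp]: "space circle_measure = sphere 0 1"
  by (simp add: circle_measure_def space_restrict_space)

lemma sets_circle_measure [measurable_cong, simp]:
  "sets circle_measure = sets (restrict_space borel (sphere 0 1))"
  by (simp add: circle_measure_def)

lemma prob_space_circle_measure: "prob_space circle_measure"
  unfolding circle_measure_def
  by (intro prob_space.prob_space_distr prob_space_uniform_measure cis_measurable_circle) auto

lemma borel_measurable_circle_measure:
  "f \<in> borel_measurable borel \<Longrightarrow> f \<in> borel_measurable circle_measure"
  unfolding measurable_cong_sets[OF sets_circle_measure refl]
  by (rule measurable_restrict_space1)

lemma measurable_cnj_circle [measurable (raw)]:
  assumes "f \<in> borel_measurable (M :: 'a measure)"
  shows "(\<lambda>z. cnj (f z)) \<in> borel_measurable M"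
  by (rule borel_measurable_continuous_on[OF _ assms]) (intro continuous_intros)

section \<open>The Hilbert space of square integrable functions on the circle\<close>

text \<open>
  Borel rather than Lebesgue measurability loses nothing: every Lebesgue measurable set or
  function agrees almost everywhere with a Borel one, and functions are identified a.e. below.
\<close>

definition square_integrable :: "(complex \<Rightarrow> complex) \<Rightarrow> bool" where
  "square_integrable f \<longleftrightarrow>
     f \<in> borel_measurable circle_measure \<and> integrable circle_measure (\<lambda>z. (cmod (f z))\<^sup>2)"

definition L_inf :: "(complex \<Rightarrow> complex) set" where
  "L_inf = {f. f \<in> borel_measurable circle_measure \<and>
               (\<exists>C. AE z in circle_measure. cmod (f z) \<le> C)}"

lemma square_integrable_zero: "square_integrable (\<lambda>_. 0)"
  by (simp add: square_integrable_def)

lemma square_integrable_bound: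
  assumes "square_integrable f" "g \<in> borel_measurable circle_measure"
    and "AE z in circle_measure. cmod (g z) \<le> C * cmod (f z)"
  shows "square_integrable g"
  unfolding square_integrable_def
proof (intro conjI assms(2))
  show "integrable circle_measure (\<lambda>z. (cmod (g z))\<^sup>2)"
  proof (rule Bochner_Integration.integrable_bound)
    show "integrable circle_measure (\<lambda>z. C\<^sup>2 * (cmod (f z))\<^sup>2)"
      using assms(1) by (auto simp: square_integrable_def)
    show "(\<lambda>z. (cmod (g z))\<^sup>2) \<in> borel_measurable circle_measure"
      using assms(2) by measurable
    show "AE z in circle_measure. norm ((cmod (g z))\<^sup>2) \<le> norm (C\<^sup>2 * (cmod (f z))\<^sup>2)"
      using assms(3)
    proof eventually_elim
      case (elim z)
      then have "(cmod (g z))\<^sup>2 \<le> (C * cmod (f z))\<^sup>2"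
        by (intro power_mono) auto
      then show ?case by (simp add: power_mult_distrib)
    qed
  qed
qed

lemma square_integrable_add:
  assumes "square_integrable f" "square_integrable g"
  shows "square_integrable (\<lambda>z. f z + g z)"
  unfolding square_integrable_def
proof (intro conjI)
  have [measurable]: "f \<in> borel_measurable circle_measure" "g \<in> borel_measurable circle_measure"
    using assms by (auto simp: square_integrable_def)
  show "(\<lambda>z. f z + g z) \<in> borel_measurable circle_measure" by measurable
  show "integrable circle_measure (\<lambda>z. (cmod (f z + g z))\<^sup>2)"
  proof (rule Bochner_Integration.integrable_bound)
    show "integrable circle_measure (\<lambda>z. 2 * (cmod (f z))\<^sup>2 + 2 * (cmod (g z))\<^sup>2)"
      using assms by (auto simp: square_integrable_def)
    show "AE z in circle_measure.
        norm ((cmod (f z + g z))\<^sup>2) \<le> norm (2 * (cmod (f z))\<^sup>2 + 2 * (cmod (g z))\<^sup>2)"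
    proof (rule AE_I2)
      fix z
      have "(cmod (f z + g z))\<^sup>2 \<le> (cmod (f z) + cmod (g z))\<^sup>2"
        by (intro power_mono norm_triangle_ineq) auto
      also have "\<dots> \<le> 2 * (cmod (f z))\<^sup>2 + 2 * (cmod (g z))\<^sup>2"
        using zero_le_power2[of "cmod (f z) - cmod (g z)"]
        by (simp add: power2_sum power2_diff)
      finally show "norm ((cmod (f z + g z))\<^sup>2) \<le> norm (2 * (cmod (f z))\<^sup>2 + 2 * (cmod (g z))\<^sup>2)"
        by simp
    qed
  qed measurable
qed

lemma integrable_mult_cnj:
  assumes "square_integrable f" "square_integrable g"
  shows "integrable circle_measure (\<lambda>z. f z * cnj (g z))"
proof (rule Bochner_Integration.integrable_bound)
  have [measurable]: "f \<in> borel_measurable circle_measure" "g \<in> borel_measurable circle_measure"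
    using assms by (auto simp: square_integrable_def)
  show "integrable circle_measure (\<lambda>z. (cmod (f z))\<^sup>2 + (cmod (g z))\<^sup>2)"
    using assms by (auto simp: square_integrable_def)
  show "(\<lambda>z. f z * cnj (g z)) \<in> borel_measurable circle_measure" by measurable
  show "AE z in circle_measure.
      norm (f z * cnj (g z)) \<le> norm ((cmod (f z))\<^sup>2 + (cmod (g z))\<^sup>2)"
  proof (rule AE_I2)
    fix z
    have "2 * (cmod (f z) * cmod (g z)) \<le> (cmod (f z))\<^sup>2 + (cmod (g z))\<^sup>2"
      using zero_le_power2[of "cmod (f z) - cmod (g z)"] by (simp add: power2_diff)
    moreover have "0 \<le> cmod (f z) * cmod (g z)" by simp
    ultimately have "cmod (f z) * cmod (g z) \<le> (cmod (f z))\<^sup>2 + (cmod (g z))\<^sup>2"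
      by linarith
    then show "norm (f z * cnj (g z)) \<le> norm ((cmod (f z))\<^sup>2 + (cmod (g z))\<^sup>2)"
      by (simp add: norm_mult)
  qed
qed

lemma square_integrable_cnj:
  "square_integrable f \<Longrightarrow> square_integrable (\<lambda>z. cnj (f z))"
  by (rule square_integrable_bound[where C = 1 and f = f]) (auto simp: square_integrable_def)

lemma square_integrable_mult:
  assumes "\<phi> \<in> L_inf" "square_integrable f"
  shows "square_integrable (\<lambda>z. \<phi> z * f z)"
proof -
  obtain C where C: "AE z in circle_measure. cmod (\<phi> z) \<le> C"
    using assms by (auto simp: L_inf_def)
  show ?thesis
  proof (rule square_integrable_bound[OF assms(2), where C = C])
    show "(\<lambda>z. \<phi> z * f z) \<in> borel_measurable circle_measure"
      using assms by (auto simp: square_integrable_def L_inf_def)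
    show "AE z in circle_measure. cmod (\<phi> z * f z) \<le> C * cmod (f z)"
      using C by eventually_elim (auto simp: norm_mult intro: mult_right_mono)
  qed
qed

lemma const_in_L_inf: "(\<lambda>_. c) \<in> L_inf"
  by (auto simp: L_inf_def)

lemma square_integrable_scale:
  "square_integrable f \<Longrightarrow> square_integrable (\<lambda>z. c * f z)"
  by (rule square_integrable_mult[OF const_in_L_inf])

definition eq_ae :: "(complex \<Rightarrow> complex) \<Rightarrow> (complex \<Rightarrow> complex) \<Rightarrow> bool" where
  "eq_ae f g \<longleftrightarrow> square_integrable f \<and> square_integrable g \<and> (AE z in circle_measure. f z = g z)"

quotient_type L2 = "complex \<Rightarrow> complex" / partial: eq_ae
proof (rule part_equivpI)
  show "\<exists>f. eq_ae f f"
    using square_integrable_zero by (auto simp: eq_ae_def)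
  show "symp eq_ae"
    by (auto simp: symp_def eq_ae_def elim: eventually_mono)
  show "transp eq_ae"
  proof (rule transpI)
    fix f g h assume fg: "eq_ae f g" and gh: "eq_ae g h"
    then have "AE z in circle_measure. f z = g z" "AE z in circle_measure. g z = h z"
      by (auto simp: eq_ae_def)
    then have "AE z in circle_measure. f z = h z"
      by eventually_elim simp
    with fg gh show "eq_ae f h" by (auto simp: eq_ae_def)
  qed
qed

lift_definition cinner :: "L2 \<Rightarrow> L2 \<Rightarrow> complex" is
  "\<lambda>f g. LINT z|circle_measure. f z * cnj (g z)"
proof -
  fix f f' g g' assume a: "eq_ae f f'" "eq_ae g g'"
  then have [measurable]: "f \<in> borel_measurable circle_measure"
    "f' \<in> borel_measurable circle_measure" "g \<in> borel_measurable circle_measure"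
    "g' \<in> borel_measurable circle_measure"
    by (auto simp: eq_ae_def square_integrable_def)
  from a have ae: "AE z in circle_measure. f z = f' z" "AE z in circle_measure. g z = g' z"
    by (auto simp: eq_ae_def)
  show "(LINT z|circle_measure. f z * cnj (g z)) = (LINT z|circle_measure. f' z * cnj (g' z))"
  proof (rule integral_cong_AE)
    show "AE z in circle_measure. f z * cnj (g z) = f' z * cnj (g' z)"
      using ae by eventually_elim simp
  qed measurable
qed

lift_definition cscale :: "complex \<Rightarrow> L2 \<Rightarrow> L2" is "\<lambda>c f z. c * f z"
  by (auto simp: eq_ae_def square_integrable_scale elim: eventually_mono)

lift_definition cnj_L2 :: "L2 \<Rightarrow> L2" is "\<lambda>f z. cnj (f z)"
  by (auto simp: eq_ae_def square_integrable_cnj elim: eventually_mono)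

text \<open>Multiplication by a function in \<open>L_inf\<close>; the value \<open>0\<close> for other symbols is a dummy.\<close>

lift_definition mult_L2 :: "(complex \<Rightarrow> complex) \<Rightarrow> L2 \<Rightarrow> L2" is
  "\<lambda>\<phi> f z. if \<phi> \<in> L_inf then \<phi> z * f z else 0"
  subgoal for \<phi> f g
    by (cases "\<phi> \<in> L_inf")
      (auto simp: eq_ae_def square_integrable_mult square_integrable_zero elim: eventually_mono)
  done

instantiation L2 :: real_vector
begin

lift_definition zero_L2 :: L2 is "\<lambda>_. 0"
  by (simp add: eq_ae_def square_integrable_zero)

lift_definition plus_L2 :: "L2 \<Rightarrow> L2 \<Rightarrow> L2" is "\<lambda>f g z. f z + g z"
  by (auto simp: eq_ae_def square_integrable_add)

lift_definition uminus_L2 :: "L2 \<Rightarrow> L2" is "\<lambda>f z. - f z"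
  using square_integrable_scale[of _ "-1"]
  by (auto simp: eq_ae_def elim: eventually_mono)

definition minus_L2 :: "L2 \<Rightarrow> L2 \<Rightarrow> L2" where "f - g = f + - (g :: L2)"

definition scaleR_L2 :: "real \<Rightarrow> L2 \<Rightarrow> L2" where "scaleR_L2 r = cscale (of_real r)"

instance
proof
  fix f g h :: L2 and r s :: real
  show "f + g + h = f + (g + h)"
    by transfer (auto simp: eq_ae_def add_ac intro: square_integrable_add)
  show "f + g = g + f"
    by transfer (auto simp: eq_ae_def add_ac intro: square_integrable_add)
  show "0 + f = f"
    by transfer (auto simp: eq_ae_def)
  show "- f + f = 0"
    by transfer (auto simp: eq_ae_def square_integrable_zero)
  show "f - g = f + - g"
    by (rule minus_L2_def)
  show "r *\<^sub>R (f + g) = r *\<^sub>R f + r *\<^sub>R g"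
    unfolding scaleR_L2_def by transfer
      (auto simp: eq_ae_def distrib_left distrib_right
        intro!: square_integrable_add square_integrable_scale)
  show "(r + s) *\<^sub>R f = r *\<^sub>R f + s *\<^sub>R f"
    unfolding scaleR_L2_def by transfer
      (auto simp: eq_ae_def distrib_left distrib_right
        intro!: square_integrable_add square_integrable_scale)
  show "r *\<^sub>R s *\<^sub>R f = (r * s) *\<^sub>R f"
    unfolding scaleR_L2_def by transfer
      (auto simp: eq_ae_def mult.assoc intro!: square_integrable_scale)
  show "1 *\<^sub>R f = f"
    unfolding scaleR_L2_def by transfer (auto simp: eq_ae_def)
qed

end

text \<open>\<open>L2.subspace\<close> is the notion of complex linear subspace.\<close>

global_interpretation L2: vector_space cscale
proof
  fix a b :: complex and f g :: L2
  show "cscale a (f + g) = cscale a f + cscale a g"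
    by transfer
      (auto simp: eq_ae_def distrib_left distrib_right
        intro!: square_integrable_add square_integrable_scale)
  show "cscale (a + b) f = cscale a f + cscale b f"
    by transfer
      (auto simp: eq_ae_def distrib_left distrib_right
        intro!: square_integrable_add square_integrable_scale)
  show "cscale a (cscale b f) = cscale (a * b) f"
    by transfer (auto simp: eq_ae_def mult.assoc intro!: square_integrable_scale)
  show "cscale 1 f = f"
    by transfer (auto simp: eq_ae_def)
qed

lemma integral_mult_cnj_self:
  "(LINT z|circle_measure. f z * cnj (f z)) = of_real (LINT z|circle_measure. (cmod (f z))\<^sup>2)"
proof -
  have "(\<lambda>z. f z * cnj (f z)) = (\<lambda>z. complex_of_real ((cmod (f z))\<^sup>2))"
    by (simp only: complex_norm_square)
  then show ?thesis
    by (simp only: integral_complex_of_real)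
qed

lemma cinner_self: "cinner f f = of_real (Re (cinner f f))" "Re (cinner f f) \<ge> 0"
proof -
  have "cinner f f = of_real (Re (cinner f f)) \<and> Re (cinner f f) \<ge> 0"
  proof transfer
    fix f :: "complex \<Rightarrow> complex"
    have "(LINT z|circle_measure. f z * cnj (f z)) =
        of_real (LINT z|circle_measure. (cmod (f z))\<^sup>2)"
      by (rule integral_mult_cnj_self)
    then show "(LINT z|circle_measure. f z * cnj (f z)) =
        of_real (Re (LINT z|circle_measure. f z * cnj (f z))) \<and>
        Re (LINT z|circle_measure. f z * cnj (f z)) \<ge> 0"
      by simp
  qed
  then show "cinner f f = of_real (Re (cinner f f))" "Re (cinner f f) \<ge> 0" by auto
qed

lemma cinner_self_eq_0: "Re (cinner f f) = 0 \<longleftrightarrow> f = 0"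
proof transfer
  fix f assume f: "eq_ae f f"
  have "(LINT z|circle_measure. f z * cnj (f z)) =
      of_real (LINT z|circle_measure. (cmod (f z))\<^sup>2)"
    by (rule integral_mult_cnj_self)
  then have "Re (LINT z|circle_measure. f z * cnj (f z)) = 0 \<longleftrightarrow>
      (LINT z|circle_measure. (cmod (f z))\<^sup>2) = 0"
    by simp
  also have "\<dots> \<longleftrightarrow> (AE z in circle_measure. (cmod (f z))\<^sup>2 = 0)"
    using f by (intro integral_nonneg_eq_0_iff_AE) (auto simp: eq_ae_def square_integrable_def)
  also have "\<dots> \<longleftrightarrow> eq_ae f (\<lambda>_. 0)"
    using f by (simp add: eq_ae_def square_integrable_zero)
  finally show "Re (LINT z|circle_measure. f z * cnj (f z)) = 0 \<longleftrightarrow> eq_ae f (\<lambda>_. 0)" .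
qed

lemma cinner_commute: "cinner f g = cnj (cinner g f)"
proof transfer
  fix f g :: "complex \<Rightarrow> complex"
  have "(\<lambda>z. f z * cnj (g z)) = (\<lambda>z. cnj (g z * cnj (f z)))"
    by (simp add: fun_eq_iff)
  then show "(LINT z|circle_measure. f z * cnj (g z)) =
      cnj (LINT z|circle_measure. g z * cnj (f z))"
    by (simp only: Bochner_Integration.integral_cnj)
qed

lemma cinner_add_left: "cinner (f + g) h = cinner f h + cinner g h"
  by transfer (simp add: eq_ae_def algebra_simps integrable_mult_cnj)

lemma cinner_scale_left: "cinner (cscale c f) h = c * cinner f h"
  by transfer (simp add: mult.assoc)

instantiation L2 :: real_inner
begin

definition inner_L2 :: "L2 \<Rightarrow> L2 \<Rightarrow> real" where "inner_L2 f g = Re (cinner f g)"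
definition norm_L2 :: "L2 \<Rightarrow> real" where "norm_L2 f = sqrt (inner f f)"
definition dist_L2 :: "L2 \<Rightarrow> L2 \<Rightarrow> real" where "dist_L2 f g = norm (f - g)"
definition sgn_L2 :: "L2 \<Rightarrow> L2" where "sgn_L2 f = f /\<^sub>R norm f"
definition uniformity_L2 :: "(L2 \<times> L2) filter" where
  "uniformity_L2 = (INF e\<in>{0<..}. principal {(f, g). dist f g < e})"
definition open_L2 :: "L2 set \<Rightarrow> bool" where
  "open_L2 U \<longleftrightarrow> (\<forall>f\<in>U. eventually (\<lambda>(f', g). f' = f \<longrightarrow> g \<in> U) uniformity)"

instance
proof
  fix f g h :: L2 and r :: real and U :: "L2 set"
  show "inner f g = inner g f"
    unfolding inner_L2_def by (subst cinner_commute) simp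
  show "inner (f + g) h = inner f h + inner g h"
    by (simp add: inner_L2_def cinner_add_left)
  show "inner (r *\<^sub>R f) g = r * inner f g"
    by (simp add: inner_L2_def scaleR_L2_def cinner_scale_left)
  show "0 \<le> inner f f"
    by (simp add: inner_L2_def cinner_self(2))
  show "inner f f = 0 \<longleftrightarrow> f = 0"
    by (simp add: inner_L2_def cinner_self_eq_0)
qed (simp_all add: norm_L2_def dist_L2_def sgn_L2_def uniformity_L2_def open_L2_def)

end

definition ortho_complement :: "L2 set \<Rightarrow> L2 set" where
  "ortho_complement M = {f. \<forall>g\<in>M. cinner f g = 0}"

text \<open>Orthogonal projection onto \<open>M\<close>; meaningful when \<open>M\<close> is a closed subspace.\<close>

definition ortho_proj :: "L2 set \<Rightarrow> L2 \<Rightarrow> L2" where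
  "ortho_proj M f = (THE g. g \<in> M \<and> f - g \<in> ortho_complement M)"

section \<open>Hardy space, inner functions and model spaces\<close>

lemma power_int_borel_measurable: "(\<lambda>z::complex. z powi n) \<in> borel_measurable circle_measure"
proof (rule borel_measurable_circle_measure)
  show "(\<lambda>z::complex. z powi n) \<in> borel_measurable borel"
    by (cases n rule: int_cases2) (simp_all add: power_int_minus)
qed

lemma fourier_coeff_cong:
  assumes a: "eq_ae f f'"
  shows "(LINT z|circle_measure. f z * z powi (- n)) = (LINT z|circle_measure. f' z * z powi (- n))"
proof -
  note [measurable] = power_int_borel_measurable
  from a have [measurable]: "f \<in> borel_measurable circle_measure"
    "f' \<in> borel_measurable circle_measure"
    by (auto simp: eq_ae_def square_integrable_def)
  from a have ae: "AE z in circle_measure. f z = f' z"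
    by (auto simp: eq_ae_def)
  show "(LINT z|circle_measure. f z * z powi (- n)) = (LINT z|circle_measure. f' z * z powi (- n))"
  proof (rule integral_cong_AE)
    show "AE z in circle_measure. f z * z powi (- n) = f' z * z powi (- n)"
      using ae by eventually_elim simp
  qed measurable
qed

lift_definition fourier_coeff :: "L2 \<Rightarrow> int \<Rightarrow> complex" is
  "\<lambda>f n. LINT z|circle_measure. f z * z powi (- n)"
  by (intro ext fourier_coeff_cong)

definition H2 :: "L2 set" where
  "H2 = {f. \<forall>n<0. fourier_coeff f n = 0}"

definition conj_H2_0 :: "L2 set" where
  "conj_H2_0 = (\<lambda>f. cnj_L2 (mult_L2 (\<lambda>z. z) f)) ` H2"

definition P_plus :: "L2 \<Rightarrow> L2" where "P_plus = ortho_proj H2"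

definition P_minus :: "L2 \<Rightarrow> L2" where "P_minus = ortho_proj conj_H2_0"

text \<open>
  An inner function is a function on the open unit disk; \<open>boundary u\<close> is the function on the
  circle given by its radial limits, which by definition exist almost everywhere.  \<open>boundary u\<close> is measurable:
  off the (Borel) set where the radial limit exists, \<open>Lim\<close> has a fixed value.
\<close>

definition inner_function :: "(complex \<Rightarrow> complex) \<Rightarrow> bool" where
  "inner_function u \<longleftrightarrow>
     u holomorphic_on ball 0 1 \<and> bounded (u ` ball 0 1) \<and>
     (AE z in circle_measure.
        \<exists>l. ((\<lambda>r. u (of_real r * z)) \<longlongrightarrow> l) (at_left (1::real)) \<and> cmod l = 1)"

definition boundary :: "(complex \<Rightarrow> complex) \<Rightarrow> complex \<Rightarrow> complex" where
  "boundary u z = Lim (at_left (1::real)) (\<lambda>r. u (of_real r * z))"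

definition model_space :: "(complex \<Rightarrow> complex) \<Rightarrow> L2 set" where
  "model_space u = H2 \<inter> ortho_complement (mult_L2 (boundary u) ` H2)"

text \<open>The dual of the compressed shift; to be applied to elements of the orthogonal
  complement of \<open>model_space u\<close> only.\<close>

definition dual_shift :: "(complex \<Rightarrow> complex) \<Rightarrow> L2 \<Rightarrow> L2" where
  "dual_shift u f = mult_L2 (\<lambda>z. z) f - ortho_proj (model_space u) (mult_L2 (\<lambda>z. z) f)"

text \<open>The operator \<open>P\<^sup>- + u cnj(u(0)) P\<^sup>+\<close>.\<close>

definition wave_op :: "(complex \<Rightarrow> complex) \<Rightarrow> L2 \<Rightarrow> L2" where
  "wave_op u g = P_minus g + mult_L2 (boundary u) (cscale (cnj (u 0)) (P_plus g))"

end

theory Submission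
  imports Defs
begin

text \<open>
  The operator \<open>W = P\<^sup>- + u cnj(u(0)) P\<^sup>+\<close> is a continuous bijection of \<open>L\<^sup>2\<close> onto the complement of
  the model space, because that complement is the sum of \<open>conj_H2_0\<close> and \<open>u H\<^sup>2\<close> and \<open>u(0) \<noteq> 0\<close>.
  It intertwines multiplication by \<open>z\<close> with the dual shift: the only Fourier mode that \<open>z\<close> moves from
  \<open>conj_H2_0\<close> into \<open>H\<^sup>2\<close> is a constant \<open>c\<close>, and \<open>P\<^sub>u 1 = 1 - cnj(u(0)) u\<close>, so that \<open>c\<close> is sent to
  \<open>c cnj(u(0)) u\<close>. Pulling \<open>S\<close> back along \<open>W\<close> thus reduces the claim to the theorems of Wiener and of
  Beurling and Helson on closed subspaces of \<open>L\<^sup>2\<close> that are invariant under multiplication by \<open>z\<close>.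
\<close>

section \<open>Integration on the circle and uniqueness of Fourier coefficients\<close>

text \<open>Behind both invariant subspace theorems is one fact: an integrable function on the
  circle whose Fourier coefficients all vanish is zero almost everywhere. It is wanted for
  integrable functions because it is applied to products \<open>f * cnj g\<close> of square
  integrable ones: orthogonality of \<open>g\<close> to every shift of \<open>f\<close> then becomes
  the pointwise identity \<open>f * cnj g = 0\<close>. Hence it is proved by approximating indicator
  functions and not by Hilbert space means. The other analytic input is completeness of
  \<open>L2\<close>, which gives \<open>ortho_proj\<close> its value on closed subspaces.

  The factor \<open>cnj (u 0)\<close> in \<open>W\<close> is forced. On the \<open>H2\<close> part
  every scalar multiple of \<open>u\<close> commutes with the shift; the scalar is fixed by the
  constant that crosses over from \<open>conj_H2_0\<close>, because the component of 1 in
  \<open>u H2\<close> is \<open>cnj (u 0) * u\<close>. For \<open>u 0 = 0\<close> that scalar would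
  be 0 and \<open>W\<close> would annihilate \<open>H2\<close>. The inner function enters through
  its boundary values only: they are measurable and unimodular, and their integrals against
  \<open>z ^ k\<close> are \<open>u 0\<close> for \<open>k = 0\<close> and 0 for
  \<open>k > 0\<close>.\<close>

lemma integral_circle_measure:
  fixes f :: "complex \<Rightarrow> complex"
  assumes [measurable]: "f \<in> borel_measurable circle_measure"
  shows "(LINT z|circle_measure. f z) = (LINT t:{0..2*pi}|lborel. f (cis t)) / (2 * pi)"
proof -
  note [measurable] = cis_measurable_circle
  have fm: "f \<in> borel_measurable (restrict_space borel (sphere 0 1))"
    using assms unfolding measurable_cong_sets[OF sets_circle_measure refl] .
  have cm: "(\<lambda>t. f (cis t)) \<in> borel_measurable lborel"
    using measurable_comp[OF cis_measurable_circle fm]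
    unfolding measurable_cong_sets[OF sets_uniform_measure refl] by (simp add: comp_def)
  have "(LINT z|circle_measure. f z) = (LINT t|uniform_measure lborel {0..2*pi}. f (cis t))"
    unfolding circle_measure_def by (intro integral_distr cis_measurable_circle fm)
  also have "uniform_measure lborel {0..2*pi} =
      density lborel (\<lambda>t. ennreal (indicator {0..2*pi} t / (2*pi)))"
    unfolding uniform_measure_def
    by (intro arg_cong2[where f = density] refl ext)
       (auto simp: divide_ennreal[symmetric] split: split_indicator)
  also have "(LINT t|\<dots>. f (cis t)) = (LINT t|lborel. (indicator {0..2*pi} t / (2*pi)) *\<^sub>R f (cis t))"
    by (intro integral_density) (use cm in \<open>auto\<close>)
  also have "\<dots> = (LINT t|lborel. (indicator {0..2*pi} t *\<^sub>R f (cis t)) / (2*pi))"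
    by (intro Bochner_Integration.integral_cong) (auto simp: scaleR_conv_of_real)
  also have "\<dots> = (LINT t:{0..2*pi}|lborel. f (cis t)) / (2 * pi)"
    unfolding set_lebesgue_integral_def by (rule integral_divide_zero)
  finally show ?thesis .
qed

text \<open>Cauchy's integral formula at the centre: along \<open>cis t\<close> the kernel
  \<open>1 / w\<close> cancels the derivative \<open>\<i> * cis t\<close> up to the factor
  \<open>\<i>\<close>. It is applied to monomials and to dilates of \<open>u\<close>.\<close>

lemma circle_mean_value:
  assumes cont: "continuous_on (cball 0 1) f" and hol: "f holomorphic_on ball 0 1"
  shows "(LINT z|circle_measure. f z) = f 0"
proof -
  have cs: "continuous_on (sphere 0 1) f"
    by (rule continuous_on_subset[OF cont]) auto
  have fm: "f \<in> borel_measurable circle_measure"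
    unfolding measurable_cong_sets[OF sets_circle_measure refl]
    by (rule borel_measurable_continuous_on_restrict[OF cs])
  have "((\<lambda>w. f w / (w - 0)) has_contour_integral (2 * of_real pi * \<i> * f 0)) (circlepath 0 1)"
    by (rule Cauchy_integral_circlepath[OF cont hol]) auto
  then have "((\<lambda>t. f (cis t) / cis t * \<i> * cis t) has_integral (2 * of_real pi * \<i> * f 0)) {0..2*pi}"
    unfolding circlepath_def by (subst (asm) has_contour_integral_part_circlepath_iff) auto
  then have "((\<lambda>t. \<i> * f (cis t)) has_integral (2 * of_real pi * \<i> * f 0)) {0..2*pi}"
    by (rule has_integral_eq[rotated]) (auto simp: field_simps)
  then have "((\<lambda>t. \<i> * f (cis t)) has_integral (\<i> * (2 * of_real pi * f 0))) {0..2*pi}"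
    by (simp only: ac_simps)
  from has_integral_mult_right[OF this, of "-\<i>"]
  have 1: "((\<lambda>t. f (cis t)) has_integral (2 * of_real pi * f 0)) {0..2*pi}"
    unfolding mult.assoc[symmetric] by simp
  have "continuous_on {0..2*pi} (\<lambda>t. f (cis t))"
    by (rule continuous_on_compose2[OF cs]) (auto intro!: continuous_intros)
  then have "set_integrable lborel {0..2*pi} (\<lambda>t. f (cis t))"
    by (rule borel_integrable_atLeastAtMost')
  from set_borel_integral_eq_integral(2)[OF this] 1
  have "(LINT t:{0..2*pi}|lborel. f (cis t)) = 2 * of_real pi * f 0"
    by (simp add: integral_unique)
  then show ?thesis
    by (simp add: integral_circle_measure[OF fm])
qed

lemma AE_in_circle [intro]: "(\<And>z. cmod z = 1 \<Longrightarrow> P z) \<Longrightarrow> AE z in circle_measure. P z"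
  by (rule AE_I2) auto

lemma inverse_eq_cnj_circle: "cmod z = 1 \<Longrightarrow> inverse z = cnj z"
  using complex_div_cnj[of 1 z] by (simp add: inverse_eq_divide)

text \<open>Non-negative powers are entire, so the mean value property applies; negative powers are
  their conjugates on the circle.\<close>

lemma integral_circle_powi: "(LINT z|circle_measure. z powi n) = (if n = 0 then 1 else 0)"
proof -
  have pos: "(LINT z|circle_measure. z ^ k) = (if k = 0 then 1 else 0)" for k
    by (subst circle_mean_value) (auto intro!: continuous_intros holomorphic_intros)
  have "(LINT z|circle_measure. z powi (- int k)) = cnj (LINT z|circle_measure. z ^ k)" for k
    unfolding Bochner_Integration.integral_cnj[symmetric]
    by (intro Bochner_Integration.integral_cong)
       (auto simp: power_int_minus inverse_eq_cnj_circle norm_power simp flip: power_inverse)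
  with pos show ?thesis
    by (cases n rule: int_cases2) auto
qed

section \<open>Integrable functions with vanishing Fourier coefficients\<close>

lemma integrable_mult_bounded:
  fixes f g :: "complex \<Rightarrow> complex"
  assumes f: "integrable circle_measure f" and g: "g \<in> borel_measurable circle_measure"
    and bd: "AE z in circle_measure. cmod (g z) \<le> C"
  shows "integrable circle_measure (\<lambda>z. f z * g z)"
proof (rule Bochner_Integration.integrable_bound)
  show "integrable circle_measure (\<lambda>z. C * cmod (f z))" using f by auto
  show "(\<lambda>z. f z * g z) \<in> borel_measurable circle_measure" using f g by measurable
  show "AE z in circle_measure. norm (f z * g z) \<le> norm (C * cmod (f z))"
    using bd by eventually_elim
      (smt (verit, best) mult.commute mult_right_mono norm_ge_zero norm_mult real_norm_def)
qed

text \<open>Quantifying over \<open>h\<close> lets the product step of the induction use its hypotheses one after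
  the other.\<close>

lemma fourier_zero_mult_polynomial:
  fixes g :: "complex \<Rightarrow> real"
  assumes "real_polynomial_function g"
  shows "integrable circle_measure h \<Longrightarrow> (\<And>n. (LINT z|circle_measure. h z * z powi n) = 0) \<Longrightarrow>
    integrable circle_measure (\<lambda>z. h z * g z) \<and>
    (\<forall>n. (LINT z|circle_measure. h z * g z * z powi n) = 0)"
  using assms
proof (induction g arbitrary: h)
  case (linear g)
  interpret bounded_linear g by fact
  note [measurable] = power_int_borel_measurable
  have ih: "integrable circle_measure (\<lambda>z. h z * z powi n)" for n
    by (rule integrable_mult_bounded[OF linear.prems(1), where C = 1])
       (auto simp: norm_power_int)
  \<comment> \<open>\<open>c\<close> is chosen so that \<open>g z = 2 * Re (c * z)\<close>. As
    \<open>cnj z\<close> is \<open>z powi (-1)\<close> on the circle, multiplication by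
    \<open>g\<close> only shifts the Fourier index by one in both directions.\<close>
  define c where "c = Complex (g 1 / 2) (- g \<i> / 2)"
  have gz: "of_real (g z) = c * z powi 1 + cnj c * z powi (-1)" if "cmod z = 1" for z
  proof -
    have z: "z powi (-1) = cnj z"
      using that by (simp add: power_int_minus inverse_eq_cnj_circle)
    have "z = Re z *\<^sub>R 1 + Im z *\<^sub>R \<i>"
      by (simp add: complex_eq_iff)
    then have "g z = Re z * g 1 + Im z * g \<i>"
      by (metis add scaleR real_scaleR_def)
    then show ?thesis unfolding z by (simp add: c_def complex_eq_iff)
  qed
  have eq: "h z * g z * z powi n = c * (h z * z powi (n + 1)) + cnj c * (h z * z powi (n - 1))"
    if "z \<in> space circle_measure" for z n
  proof -
    have "cmod z = 1" "z \<noteq> 0" using that by auto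
    then show ?thesis
      by (subst gz) (auto simp: power_int_add power_int_diff power_int_minus field_simps)
  qed
  have "integrable circle_measure (\<lambda>z. h z * g z * z powi n) \<and>
      (LINT z|circle_measure. h z * g z * z powi n) = 0" for n
  proof -
    have "integrable circle_measure (\<lambda>z. h z * g z * z powi n) \<longleftrightarrow> integrable circle_measure
        (\<lambda>z. c * (h z * z powi (n + 1)) + cnj c * (h z * z powi (n - 1)))"
      by (intro Bochner_Integration.integrable_cong eq refl)
    moreover have "(LINT z|circle_measure. h z * g z * z powi n) = (LINT z|circle_measure.
        c * (h z * z powi (n + 1)) + cnj c * (h z * z powi (n - 1)))"
      by (intro Bochner_Integration.integral_cong eq refl)
    ultimately show ?thesis using linear.prems(2) ih by simp
  qed
  from this this[of 0] show ?case by simp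
next
  case (const c)
  have "(\<lambda>z. h z * of_real c * z powi n) = (\<lambda>z. of_real c * (h z * z powi n))" for n
    by (auto simp: ac_simps)
  with const show ?case by simp
next
  case (add f g)
  note [measurable] = power_int_borel_measurable
  have ip: "integrable circle_measure (\<lambda>z. k z * z powi n)" if "integrable circle_measure k" for n k
    by (rule integrable_mult_bounded[OF that, where C = 1]) (auto simp: norm_power_int)
  have f: "integrable circle_measure (\<lambda>z. h z * f z)"
      "\<And>n. (LINT z|circle_measure. h z * f z * z powi n) = 0"
    and g: "integrable circle_measure (\<lambda>z. h z * g z)"
      "\<And>n. (LINT z|circle_measure. h z * g z * z powi n) = 0"
    using add.IH(1)[OF add.prems] add.IH(2)[OF add.prems] by auto
  have "(LINT z|circle_measure. h z * of_real (f z + g z) * z powi n) = 0" for n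
    using f(2)[of n] g(2)[of n] Bochner_Integration.integral_add[OF ip[OF f(1), of n] ip[OF g(1), of n]]
    by (simp add: algebra_simps)
  moreover have "integrable circle_measure (\<lambda>z. h z * of_real (f z + g z))"
    using Bochner_Integration.integrable_add[OF f(1) g(1)] by (simp add: algebra_simps)
  ultimately show ?case by simp
next
  case (mult f g)
  from mult.IH(1)[OF mult.prems] have "integrable circle_measure (\<lambda>z. h z * f z)"
    "\<And>n. (LINT z|circle_measure. h z * f z * z powi n) = 0" by auto
  from mult.IH(2)[OF this] show ?case by (simp add: algebra_simps)
qed

lemma circle_borel_continuous:
  "continuous_on (sphere 0 1) f \<Longrightarrow> f \<in> borel_measurable circle_measure"
  unfolding measurable_cong_sets[OF sets_circle_measure refl]
  by (rule borel_measurable_continuous_on_restrict)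

text \<open>By Stone-Weierstrass, real polynomials approximate \<open>g\<close> uniformly on the
  compact circle, and the resulting error is at most \<open>d\<close> times the \<open>L^1\<close>
  norm of \<open>f\<close>.\<close>

lemma fourier_zero_mult_continuous:
  fixes g :: "complex \<Rightarrow> real"
  assumes f: "integrable circle_measure f" and z: "\<And>n. (LINT z|circle_measure. f z * z powi n) = 0"
    and g: "continuous_on (sphere 0 1) g"
  shows "(LINT z|circle_measure. f z * g z) = 0"
proof -
  let ?N = "LINT z|circle_measure. cmod (f z)"
  have N: "?N \<ge> 0" by simp
  have "cmod (LINT z|circle_measure. f z * g z) \<le> e" if "e > 0" for e :: real
  proof -
    \<comment> \<open>The \<open>+ 1\<close> keeps the denominator positive when
      \<open>?N = 0\<close>; the final error \<open>d * ?N\<close> is still at most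
      \<open>e\<close>.\<close>
    define d where "d = e / (?N + 1)"
    have d: "d > 0" using that N by (auto simp: d_def intro!: divide_pos_pos add_nonneg_pos)
    obtain p where p: "real_polynomial_function p" "\<And>x. x \<in> sphere 0 1 \<Longrightarrow> \<bar>g x - p x\<bar> < d"
      using Stone_Weierstrass_real_polynomial_function[OF compact_sphere g d] by blast
    have ip: "integrable circle_measure (\<lambda>z. f z * p z)"
      "(LINT z|circle_measure. f z * p z) = 0"
      using fourier_zero_mult_polynomial[OF p(1) f z] by (auto dest: spec[of _ 0])
    have cp: "continuous_on (sphere 0 1) p"
      using p(1) continuous_on_polymonial_function real_polynomial_function_eq by blast
    have id: "integrable circle_measure (\<lambda>z. f z * of_real (g z - p z))"
      by (rule integrable_mult_bounded[OF f, where C = d])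
         (use g cp p(2) in \<open>auto intro!: circle_borel_continuous continuous_intros AE_in_circle less_imp_le simp del: of_real_diff\<close>)
    have "(LINT z|circle_measure. f z * g z) =
        (LINT z|circle_measure. f z * of_real (g z - p z) + f z * p z)"
      by (simp add: algebra_simps)
    also have "\<dots> = (LINT z|circle_measure. f z * of_real (g z - p z))"
      using id ip by simp
    also have "cmod \<dots> \<le> (LINT z|circle_measure. d * cmod (f z))"
    proof (rule Bochner_Integration.integral_norm_bound_integral[OF id])
      show "integrable circle_measure (\<lambda>z. d * cmod (f z))" using f by auto
      fix z assume "z \<in> space circle_measure"
      then have "\<bar>g z - p z\<bar> \<le> d" using p(2)[of z] by auto
      then show "norm (f z * of_real (g z - p z)) \<le> d * cmod (f z)"
        unfolding norm_mult norm_of_real by (metis mult.commute mult_right_mono norm_ge_zero)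
    qed
    also have "\<dots> = d * ?N" by simp
    also have "\<dots> \<le> d * (?N + 1)" using d by (intro mult_left_mono) auto
    also have "\<dots> = e" using add_nonneg_pos[OF N zero_less_one] by (simp add: d_def)
    finally show ?thesis .
  qed
  then have "cmod (LINT z|circle_measure. f z * g z) \<le> 0"
    by (meson dense_ge)
  then show ?thesis by simp
qed

text \<open>The indicator of a closed set is a pointwise limit of continuous functions with values
  between 0 and 1, so dominated convergence with bound \<open>cmod (f z)\<close> applies.\<close>

lemma fourier_zero_closed:
  assumes f: "integrable circle_measure f" and z: "\<And>n. (LINT z|circle_measure. f z * z powi n) = 0"
    and C: "closed C"
  shows "(LINT z|circle_measure. indicator C z *\<^sub>R f z) = 0"
proof (cases "C = {}")
  case False
  \<comment> \<open>Continuous cut-offs, equal to 1 on \<open>C\<close> and to 0 at distance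
    \<open>1 / k\<close> or more. The empty set is treated apart because \<open>infdist z {}\<close>
    is 0 by convention, which would make every cut-off 1.\<close>
  define g where "g k z = max 0 (1 - real k * infdist z C)" for k z
  have lim: "(\<lambda>k. g k z) \<longlonglongrightarrow> indicator C z" for z
  proof (cases "z \<in> C")
    case True
    then show ?thesis by (simp add: g_def)
  next
    case z: False
    then have d: "infdist z C > 0"
      using C False infdist_pos_not_in_closed by auto
    obtain N where N: "real N * infdist z C > 1"
      using reals_Archimedean3[OF d] by blast
    have "\<forall>\<^sub>F k in sequentially. g k z = indicator C z"
      using eventually_ge_at_top[of N]
    proof eventually_elim
      case (elim k)
      then have "real N * infdist z C \<le> real k * infdist z C"
        using d by (intro mult_right_mono) auto
      with N z show ?case by (auto simp: g_def)
    qed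
    then show ?thesis by (rule tendsto_eventually)
  qed
  have cg: "continuous_on (sphere 0 1) (g k)" for k
    unfolding g_def by (intro continuous_intros)
  note [measurable] = circle_borel_continuous[OF cg] borel_measurable_integrable[OF f]
  have [measurable]: "indicator C \<in> borel_measurable circle_measure"
    using C by (intro borel_measurable_circle_measure) auto
  have "(\<lambda>k. LINT z|circle_measure. g k z *\<^sub>R f z) \<longlonglongrightarrow> (LINT z|circle_measure. indicator C z *\<^sub>R f z)"
  proof (rule integral_dominated_convergence)
    show "integrable circle_measure (\<lambda>z. cmod (f z))" using f by auto
    show "AE z in circle_measure. (\<lambda>k. g k z *\<^sub>R f z) \<longlonglongrightarrow> indicator C z *\<^sub>R f z"
      by (intro AE_I2 tendsto_intros lim)
    show "AE z in circle_measure. norm (g k z *\<^sub>R f z) \<le> cmod (f z)" for k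
    proof (rule AE_I2)
      fix z have "\<bar>g k z\<bar> \<le> 1" by (auto simp: g_def infdist_nonneg)
      then show "norm (g k z *\<^sub>R f z) \<le> cmod (f z)"
        by (simp add: mult_left_le_one_le)
    qed
  qed measurable
  moreover have "(LINT z|circle_measure. g k z *\<^sub>R f z) = 0" for k
    using fourier_zero_mult_continuous[OF f z cg[of k]] by (simp add: scaleR_conv_of_real mult.commute)
  ultimately show ?thesis by (simp add: LIMSEQ_const_iff)
qed simp

text \<open>Dynkin's argument: the closed sets are an intersection-stable generator of the Borel
  sets. Complements are handled by the coefficient at index 0, disjoint unions by countable
  additivity of the integral.\<close>

lemma fourier_zero_borel:
  assumes f: "integrable circle_measure f" and z: "\<And>n. (LINT z|circle_measure. f z * z powi n) = 0"
    and A: "A \<in> sets borel"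
  shows "(LINT z|circle_measure. indicator A z *\<^sub>R f z) = 0"
proof -
  have sb: "sets (borel :: complex measure) = sigma_sets UNIV (Collect closed)"
    by (simp add: borel_eq_closed)
  have ind: "(indicator B :: _ \<Rightarrow> real) \<in> borel_measurable circle_measure"
    if "B \<in> sets borel" for B :: "complex set"
    using that by (intro borel_measurable_circle_measure) auto
  have on_sphere: "(LINT z|circle_measure. indicator B z *\<^sub>R f z) =
      (LINT z:(sphere 0 1 \<inter> B)|circle_measure. f z)" for B
    unfolding set_lebesgue_integral_def
    by (intro Bochner_Integration.integral_cong) (auto split: split_indicator)
  have int: "integrable circle_measure (\<lambda>z. indicator B z *\<^sub>R f z)" if "B \<in> sets borel" for B
    by (rule Bochner_Integration.integrable_bound[OF f])
       (use ind[OF that] borel_measurable_integrable[OF f] in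
         \<open>auto split: split_indicator intro!: borel_measurable_scaleR\<close>)
  have "Int_stable (Collect closed :: complex set set)"
    by (auto simp: Int_stable_def)
  moreover have "(Collect closed :: complex set set) \<subseteq> Pow UNIV" by auto
  moreover have "A \<in> sigma_sets UNIV (Collect closed)" using A sb by auto
  ultimately show ?thesis
  proof (induction rule: sigma_sets_induct_disjoint)
    case (basic A)
    then show ?case using fourier_zero_closed[OF f z] by auto
  next
    case (compl A)
    have "(LINT z|circle_measure. f z) = 0" using z[of 0] by simp
    moreover have "(LINT z|circle_measure. indicator (UNIV - A) z *\<^sub>R f z) =
        (LINT z|circle_measure. f z - indicator A z *\<^sub>R f z)"
      by (intro Bochner_Integration.integral_cong) (auto split: split_indicator)
    ultimately show ?case using compl int[of A] f sb by simp
  next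
    case (union A)
    have b: "A i \<in> sets borel" for i using union(2) sb by auto
    have sphere: "sphere 0 1 \<inter> A i \<in> sets circle_measure" for i
      using b by (auto simp: sets_restrict_space)
    have "set_integrable circle_measure (\<Union>i. sphere 0 1 \<inter> A i) f"
      by (rule integrable_mult_indicator[OF _ f, folded set_integrable_def])
         (rule sets.countable_UN', use sphere in auto)
    then have "(LINT z:(\<Union>i. sphere 0 1 \<inter> A i)|circle_measure. f z) =
        (\<Sum>i. LINT z:(sphere 0 1 \<inter> A i)|circle_measure. f z)"
      using union(1) by (intro lebesgue_integral_countable_add sphere) (auto simp: disjoint_family_on_def)
    moreover have "(\<Union>i. sphere 0 1 \<inter> A i) = sphere 0 1 \<inter> (\<Union>i. A i)" by blast
    ultimately show ?case using union(3) by (simp add: on_sphere)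
  qed simp
qed

text \<open>The integral of \<open>f\<close> over each measurable set is 0, and an integrable
  function is determined almost everywhere by these integrals.\<close>

theorem fourier_zero_imp_AE_zero:
  assumes f: "integrable circle_measure f" and z: "\<And>n. (LINT z|circle_measure. f z * z powi n) = 0"
  shows "AE z in circle_measure. f z = 0"
proof -
  interpret prob_space circle_measure by (rule prob_space_circle_measure)
  show ?thesis
  proof (rule density_unique_banach[OF f])
    fix A assume "A \<in> sets circle_measure"
    then obtain B where B: "A = sphere 0 1 \<inter> B" "B \<in> sets borel"
      by (auto simp: sets_restrict_space)
    have "set_lebesgue_integral circle_measure A f = (LINT z|circle_measure. indicator B z *\<^sub>R f z)"
      unfolding set_lebesgue_integral_def B
      by (intro Bochner_Integration.integral_cong) (auto split: split_indicator)
    then show "set_lebesgue_integral circle_measure A f = set_lebesgue_integral circle_measure A (\<lambda>_. 0)"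
      using fourier_zero_borel[OF f z B(2)] by (simp add: set_lebesgue_integral_def)
  qed simp
qed

section \<open>Completeness and orthogonal projections\<close>

text \<open>A minimising sequence for the distance is Cauchy, its limit \<open>p\<close> is a
  nearest point, and a move from \<open>p\<close> along \<open>m\<close> cannot shorten the
  distance. Only the real inner product occurs here; complex orthogonality is recovered in
  \<open>ortho_proj\<close>.\<close>

theorem closed_subspace_projection:
  fixes M :: "'a::{real_inner, complete_space} set"
  assumes M: "subspace M" "closed M"
  obtains p where "p \<in> M" "\<And>m. m \<in> M \<Longrightarrow> inner (x - p) m = 0"
proof -
  have ne: "M \<noteq> {}" using M subspace_0 by auto
  define d where "d = infdist x M"
  have d0: "d \<ge> 0" by (simp add: d_def infdist_nonneg)
  have dle: "d\<^sup>2 \<le> (norm (x - y))\<^sup>2" if "y \<in> M" for y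
    using infdist_le[OF that, of x] d0 by (intro power_mono) (auto simp: d_def dist_norm)
  have "\<exists>y\<in>M. (norm (x - y))\<^sup>2 < d\<^sup>2 + e" if "e > 0" for e
  proof -
    have "sqrt (d\<^sup>2 + e) > d"
      using that d0 by (simp add: real_less_rsqrt)
    then obtain y where "y \<in> M" "dist x y < sqrt (d\<^sup>2 + e)"
      using ne cINF_less_iff[of M "dist x"] unfolding d_def infdist_def
      by (auto intro: bdd_belowI2[where m=0])
    then show ?thesis
      using that real_sqrt_less_iff[of "(norm (x - y))\<^sup>2" "d\<^sup>2 + e"]
      by (auto simp: dist_norm intro!: bexI[of _ y])
  qed
  then have "\<exists>y\<in>M. (norm (x - y))\<^sup>2 < d\<^sup>2 + 1 / real (Suc n)" for n
    by simp
  then obtain Y where Y: "\<And>n. Y n \<in> M" "\<And>n. (norm (x - Y n))\<^sup>2 < d\<^sup>2 + 1 / real (Suc n)"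
    by metis
  \<comment> \<open>The parallelogram law for \<open>x - y\<close> and \<open>x - y'\<close>: the
    midpoint of \<open>y\<close> and \<open>y'\<close> lies in \<open>M\<close>, hence at distance
    at least \<open>d\<close> from \<open>x\<close>.\<close>
  have close: "(norm (y - y'))\<^sup>2 \<le> 4 * e"
    if y: "y \<in> M" "y' \<in> M" "(norm (x - y))\<^sup>2 \<le> d\<^sup>2 + e" "(norm (x - y'))\<^sup>2 \<le> d\<^sup>2 + e" for y y' e
  proof -
    have "(1/2) *\<^sub>R (y + y') \<in> M"
      using y M by (intro subspace_scale subspace_add) auto
    then have "d\<^sup>2 \<le> (norm (x - (1/2) *\<^sub>R (y + y')))\<^sup>2" by (rule dle)
    moreover have "(norm (y - y'))\<^sup>2 + 4 * (norm (x - (1/2) *\<^sub>R (y + y')))\<^sup>2 =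
        2 * (norm (x - y))\<^sup>2 + 2 * (norm (x - y'))\<^sup>2"
      unfolding power2_norm_eq_inner
      by (simp add: inner_diff_left inner_diff_right inner_add_left inner_add_right inner_commute
          algebra_simps)
    ultimately show ?thesis using y by linarith
  qed
  have "Cauchy Y"
  proof (rule metric_CauchyI)
    fix e :: real assume e: "e > 0"
    obtain N where N: "1 / real (Suc N) < e\<^sup>2 / 4"
      using nat_approx_posE[of "e\<^sup>2 / 4"] e by auto
    have "dist (Y m) (Y n) < e" if "m \<ge> N" "n \<ge> N" for m n
    proof -
      have le: "(norm (x - Y k))\<^sup>2 \<le> d\<^sup>2 + 1 / real (Suc N)" if "k \<ge> N" for k
      proof -
        have "1 / real (Suc k) \<le> 1 / real (Suc N)"
          using that by (intro divide_left_mono) auto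
        with Y(2)[of k] show ?thesis by linarith
      qed
      have "(norm (Y m - Y n))\<^sup>2 \<le> 4 * (1 / real (Suc N))"
        using that by (intro close Y le)
      also have "\<dots> < e\<^sup>2" using N by simp
      finally show ?thesis using e by (simp add: dist_norm power_less_imp_less_base)
    qed
    then show "\<exists>N. \<forall>m\<ge>N. \<forall>n\<ge>N. dist (Y m) (Y n) < e" by blast
  qed
  then obtain p where p: "Y \<longlonglongrightarrow> p"
    using Cauchy_convergent convergent_def by blast
  have pM: "p \<in> M"
    using M(2) Y(1) p closed_sequentially by blast
  have "(norm (x - p))\<^sup>2 \<le> d\<^sup>2"
  proof (rule LIMSEQ_le)
    show "(\<lambda>n. (norm (x - Y n))\<^sup>2) \<longlonglongrightarrow> (norm (x - p))\<^sup>2"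
      by (intro tendsto_intros p)
    have "(\<lambda>n. d\<^sup>2 + 1 / real (Suc n)) \<longlonglongrightarrow> d\<^sup>2 + 0"
      by (intro tendsto_add tendsto_const LIMSEQ_Suc lim_1_over_n)
    then show "(\<lambda>n. d\<^sup>2 + 1 / real (Suc n)) \<longlonglongrightarrow> d\<^sup>2" by simp
    show "\<exists>N. \<forall>n\<ge>N. (norm (x - Y n))\<^sup>2 \<le> d\<^sup>2 + 1 / real (Suc n)"
      using Y(2) less_imp_le by blast
  qed
  moreover have "inner (x - p) m = 0" if m: "m \<in> M" "(norm (x - p))\<^sup>2 \<le> d\<^sup>2" for m
  proof (cases "m = 0")
    case False
    then have mm: "inner m m > 0" by simp
    \<comment> \<open>The coefficient of the projection of \<open>x - p\<close> onto the line
      through \<open>m\<close>, where the squared distance is a minimal quadratic in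
      \<open>t\<close>.\<close>
    define t where "t = inner (x - p) m / inner m m"
    have "(norm (x - p))\<^sup>2 \<le> (norm (x - (p + t *\<^sub>R m)))\<^sup>2"
      using dle[OF subspace_add[OF M(1) pM subspace_scale[OF M(1) m(1)]]] m(2) by (rule order.trans[rotated])
    also have "\<dots> = (norm ((x - p) - t *\<^sub>R m))\<^sup>2" by (simp add: diff_diff_eq)
    also have "\<dots> = (norm (x - p))\<^sup>2 - 2 * t * inner (x - p) m + t * t * inner m m"
    proof -
      have "(norm (t *\<^sub>R m))\<^sup>2 = t * t * inner m m"
        unfolding power2_norm_eq_inner by simp
      then show ?thesis
        using dot_norm_neg[of "x - p" "t *\<^sub>R m"] unfolding inner_scaleR_right by simp
    qed
    also have "t * t * inner m m = t * inner (x - p) m"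
      using mm by (simp add: t_def)
    finally have "t * inner (x - p) m \<le> 0" by simp
    then have "(inner (x - p) m)\<^sup>2 / inner m m \<le> 0"
      by (simp add: t_def power2_eq_square)
    then show ?thesis using mm by (simp add: divide_le_0_iff)
  qed simp
  ultimately show thesis using that pM by blast
qed

section \<open>Representatives of classes and completeness of \<open>L2\<close>\<close>

lemma square_integrable_rep: "square_integrable (rep_L2 f)"
  using Quotient_rep_reflp[OF Quotient_L2, of f] by (simp add: eq_ae_def)

lemma borel_measurable_rep [measurable]: "rep_L2 f \<in> borel_measurable circle_measure"
  using square_integrable_rep[of f] by (simp add: square_integrable_def)

lemma rep_abs_L2: "square_integrable f \<Longrightarrow> AE z in circle_measure. rep_L2 (abs_L2 f) z = f z"
  using Quotient_rep_abs[OF Quotient_L2, of f] by (simp add: eq_ae_def)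

lemma abs_rep_L2: "abs_L2 (rep_L2 f) = f"
  by (rule Quotient_abs_rep[OF Quotient_L2])

lemma cinner_rep: "cinner f g = (LINT z|circle_measure. rep_L2 f z * cnj (rep_L2 g z))"
  by (rule cinner.rep_eq)

text \<open>Each operation is known on representatives only up to a null set, so identities in
  \<open>L2\<close> are proved by combining such facts almost everywhere.\<close>

lemma L2_eqI:
  assumes "AE z in circle_measure. rep_L2 f z = rep_L2 g z"
  shows "f = g"
  using Quotient_rel_rep[OF Quotient_L2, of f g] assms square_integrable_rep by (simp add: eq_ae_def)

lemma norm_L2_power2: "(norm f)\<^sup>2 = (LINT z|circle_measure. (cmod (rep_L2 f z))\<^sup>2)"
  by (simp add: power2_norm_eq_inner inner_L2_def cinner_rep integral_mult_cnj_self)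

lemma rep_diff: "AE z in circle_measure. rep_L2 (f - g) z = rep_L2 f z - rep_L2 g z"
proof -
  have "AE z in circle_measure. rep_L2 (f - g) z = rep_L2 f z + rep_L2 (-g) z"
    unfolding minus_L2_def
    using rep_abs_L2[OF square_integrable_add[OF square_integrable_rep[of f] square_integrable_rep[of "-g"]]]
      plus_L2.abs_eq[of "rep_L2 f" "rep_L2 (-g)"]
    by (simp add: abs_rep_L2 eq_ae_def square_integrable_rep)
  moreover have "AE z in circle_measure. rep_L2 (-g) z = - rep_L2 g z"
    using rep_abs_L2[OF square_integrable_scale[OF square_integrable_rep[of g], of "-1"]]
      uminus_L2.abs_eq[of "rep_L2 g"]
    by (simp add: abs_rep_L2 eq_ae_def square_integrable_rep)
  ultimately show ?thesis by eventually_elim simp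
qed

text \<open>The Riesz-Fischer argument: a rapidly Cauchy subsequence converges almost everywhere,
  and Fatou's lemma carries the norm estimates over to the pointwise limit.\<close>

instance L2 :: complete_space
proof
  fix X :: "nat \<Rightarrow> L2" assume X: "Cauchy X"
  interpret prob_space circle_measure by (rule prob_space_circle_measure)
  define F where "F n = rep_L2 (X n)" for n
  have [measurable]: "F n \<in> borel_measurable circle_measure" for n
    by (simp add: F_def)
  have nrm: "(\<integral>\<^sup>+z. ennreal ((cmod (F m z - F n z))\<^sup>2) \<partial>circle_measure) = ennreal ((norm (X m - X n))\<^sup>2)" for m n
  proof -
    have "(\<integral>\<^sup>+z. ennreal ((cmod (F m z - F n z))\<^sup>2) \<partial>circle_measure) =
       (\<integral>\<^sup>+z. ennreal ((cmod (rep_L2 (X m - X n) z))\<^sup>2) \<partial>circle_measure)"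
      using rep_diff[of "X m" "X n"]
      by (intro nn_integral_cong_AE) (auto elim!: eventually_mono simp: F_def)
    also have "\<dots> = ennreal (LINT z|circle_measure. (cmod (rep_L2 (X m - X n) z))\<^sup>2)"
      using square_integrable_rep by (intro nn_integral_eq_integral) (auto simp: square_integrable_def)
    finally show ?thesis by (simp add: norm_L2_power2)
  qed
  have "\<exists>r. strict_mono r \<and> (\<forall>k. norm (X (r (Suc k)) - X (r k)) < (1/4)^k)"
  proof -
    have "\<exists>N. \<forall>m\<ge>N. \<forall>n\<ge>N. dist (X m) (X n) < (1/4)^k" for k :: nat
      using X by (intro metric_CauchyD) auto
    then obtain N where N: "\<And>k m n. m \<ge> N k \<Longrightarrow> n \<ge> N k \<Longrightarrow> dist (X m) (X n) < (1/4)^k"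
      by metis
    define r where "r = rec_nat (N 0) (\<lambda>k m. max (Suc m) (N (Suc k)))"
    have r: "r (Suc k) > r k" "r k \<ge> N k" for k
      by (auto simp: r_def) (cases k, auto)
    have "strict_mono r" by (simp add: strict_mono_Suc_iff r)
    moreover have "norm (X (r (Suc k)) - X (r k)) < (1/4)^k" for k
      using N[of k "r (Suc k)" "r k"] r[of k] by (simp add: dist_norm)
    ultimately show ?thesis by blast
  qed
  then obtain r where r: "strict_mono r" "\<And>k. norm (X (r (Suc k)) - X (r k)) < (1/4)^k"
    by blast
  define D where "D k z = cmod (F (r (Suc k)) z - F (r k) z)" for k z
  have [measurable]: "D k \<in> borel_measurable circle_measure" for k
    unfolding D_def by measurable
  \<comment> \<open>The inequality between arithmetic and geometric means trades square integrals
    for integrals. With squared norms below \<open>(1/16)^k\<close> it bounds the integral of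
    \<open>D k\<close> by \<open>(1/8)^k + (1/2)^k\<close>, which is summable.\<close>
  have D: "D k z \<le> 2^k * (D k z)\<^sup>2 + (1/2)^k" for k z
  proof -
    have "0 \<le> (2^k * D k z - 1)\<^sup>2 / 2^k" by simp
    also have "\<dots> = 2^k * (D k z)\<^sup>2 + (1/2)^k - 2 * D k z"
      by (simp add: power2_diff add_divide_distrib diff_divide_distrib power_one_over power_mult_distrib)
        (simp add: power2_eq_square)
    finally show ?thesis using norm_ge_zero[of "F (r (Suc k)) z - F (r k) z"] unfolding D_def by linarith
  qed
  have "(\<integral>\<^sup>+z. ennreal (D k z) \<partial>circle_measure) \<le> ennreal (2 * (1/2)^k)" for k
  proof -
    have "(\<integral>\<^sup>+z. ennreal (D k z) \<partial>circle_measure) \<le>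
        (\<integral>\<^sup>+z. ennreal (2^k) * ennreal ((D k z)\<^sup>2) + ennreal ((1/2)^k) \<partial>circle_measure)"
      using D by (intro nn_integral_mono) (simp flip: ennreal_mult ennreal_plus)
    also have "\<dots> = ennreal (2^k) * (\<integral>\<^sup>+z. ennreal ((D k z)\<^sup>2) \<partial>circle_measure) + ennreal ((1/2)^k)"
      by (simp add: nn_integral_add nn_integral_cmult emeasure_space_1[simplified])
    also have "(\<integral>\<^sup>+z. ennreal ((D k z)\<^sup>2) \<partial>circle_measure) = ennreal ((norm (X (r (Suc k)) - X (r k)))\<^sup>2)"
      unfolding D_def by (rule nrm)
    also have "\<dots> \<le> ennreal (((1/4)^k)\<^sup>2)"
      using r(2)[of k] by (intro ennreal_leI power_mono) auto
    also have "ennreal (2^k) * ennreal (((1/4)^k)\<^sup>2) + ennreal ((1/2)^k) = ennreal (2^k * ((1/4)^k)\<^sup>2 + (1/2)^k)"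
      by (simp flip: ennreal_mult ennreal_plus)
    also have "\<dots> \<le> ennreal (2 * (1/2)^k)"
    proof (rule ennreal_leI)
      have "(2::real)^k * ((1/4)^k)\<^sup>2 = (1/8)^k"
        by (simp add: power_mult_distrib[symmetric] power2_eq_square)
      also have "\<dots> \<le> (1/2)^k" by (intro power_mono) auto
      finally show "(2::real)^k * ((1/4)^k)\<^sup>2 + (1/2)^k \<le> 2 * (1/2)^k" by simp
    qed
    finally show ?thesis by (simp add: mult_left_mono add_right_mono)
  qed
  then have "(\<Sum>k. \<integral>\<^sup>+z. ennreal (D k z) \<partial>circle_measure) \<le> (\<Sum>k. ennreal (2 * (1/2)^k))"
    by (intro suminf_le) auto
  also have "\<dots> = ennreal (\<Sum>k. 2 * (1/2)^k)"
    by (intro suminf_ennreal2 summable_mult summable_geometric) auto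
  also have "\<dots> < \<infinity>" by simp
  finally have "(\<integral>\<^sup>+z. (\<Sum>k. ennreal (D k z)) \<partial>circle_measure) \<noteq> \<infinity>"
    by (subst nn_integral_suminf) auto
  then have "AE z in circle_measure. (\<Sum>k. ennreal (D k z)) \<noteq> \<infinity>"
    by (intro nn_integral_noteq_infinite) auto
  then have conv: "AE z in circle_measure. convergent (\<lambda>k. F (r k) z)"
  proof eventually_elim
    case (elim z)
    then have "summable (\<lambda>k. D k z)"
      by (intro summable_suminf_not_top) (auto simp: D_def)
    then have "summable (\<lambda>k. F (r (Suc k)) z - F (r k) z)"
      unfolding D_def by (rule summable_norm_cancel)
    then have "convergent (\<lambda>n. \<Sum>k<n. F (r (Suc k)) z - F (r k) z)"
      by (simp add: summable_iff_convergent)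
    then have "convergent (\<lambda>n. F (r n) z - F (r 0) z)"
      using sum_lessThan_telescope[of "\<lambda>k. F (r k) z"] by simp
    from convergent_add[OF this convergent_const[of "F (r 0) z"]] show ?case by simp
  qed
  \<comment> \<open>At points of divergence \<open>lim\<close> has an arbitrary value; by
    \<open>conv\<close> they form a null set.\<close>
  define f where "f z = lim (\<lambda>k. F (r k) z)" for z
  have [measurable]: "f \<in> borel_measurable circle_measure"
    unfolding f_def by measurable
  have fatou: "(\<integral>\<^sup>+z. ennreal ((cmod (f z - F n z))\<^sup>2) \<partial>circle_measure) \<le> ennreal (e\<^sup>2)"
    if N: "\<And>m. m \<ge> N \<Longrightarrow> dist (X m) (X n) < e" for e n N
  proof -
    have "(\<integral>\<^sup>+z. ennreal ((cmod (f z - F n z))\<^sup>2) \<partial>circle_measure) =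
        (\<integral>\<^sup>+z. liminf (\<lambda>k. ennreal ((cmod (F (r k) z - F n z))\<^sup>2)) \<partial>circle_measure)"
    proof (rule nn_integral_cong_AE)
      show "AE z in circle_measure. ennreal ((cmod (f z - F n z))\<^sup>2) =
          liminf (\<lambda>k. ennreal ((cmod (F (r k) z - F n z))\<^sup>2))"
        using conv
      proof eventually_elim
        case (elim z)
        then have "(\<lambda>k. F (r k) z) \<longlonglongrightarrow> f z"
          unfolding f_def by (simp add: convergent_LIMSEQ_iff)
        then have "(\<lambda>k. ennreal ((cmod (F (r k) z - F n z))\<^sup>2)) \<longlonglongrightarrow> ennreal ((cmod (f z - F n z))\<^sup>2)"
          by (intro tendsto_intros)
        then show ?case using lim_imp_Liminf[OF sequentially_bot] by metis
      qed
    qed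
    also have "\<dots> \<le> liminf (\<lambda>k. \<integral>\<^sup>+z. ennreal ((cmod (F (r k) z - F n z))\<^sup>2) \<partial>circle_measure)"
      by (rule nn_integral_liminf) measurable
    also have "\<dots> \<le> limsup (\<lambda>k. \<integral>\<^sup>+z. ennreal ((cmod (F (r k) z - F n z))\<^sup>2) \<partial>circle_measure)"
      by (rule Liminf_le_Limsup) simp
    also have "\<dots> \<le> ennreal (e\<^sup>2)"
    proof (rule Limsup_bounded)
      show "\<forall>\<^sub>F k in sequentially. (\<integral>\<^sup>+z. ennreal ((cmod (F (r k) z - F n z))\<^sup>2) \<partial>circle_measure) \<le> ennreal (e\<^sup>2)"
        using eventually_ge_at_top[of N]
      proof eventually_elim
        case (elim k)
        then have "r k \<ge> N" using strict_mono_imp_increasing[OF r(1), of k] by simp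
        then have "norm (X (r k) - X n) < e" using N[of "r k"] by (simp add: dist_norm)
        then show ?case unfolding nrm by (intro ennreal_leI power_mono) auto
      qed
    qed
    finally show ?thesis .
  qed
  have int: "integrable circle_measure (\<lambda>z. (cmod (f z - F n z))\<^sup>2)"
    and le: "(LINT z|circle_measure. (cmod (f z - F n z))\<^sup>2) \<le> e\<^sup>2"
    if "\<And>m. m \<ge> N \<Longrightarrow> dist (X m) (X n) < e" for e n N
  proof -
    show *: "integrable circle_measure (\<lambda>z. (cmod (f z - F n z))\<^sup>2)"
      using order.strict_trans1[OF fatou[OF that] ennreal_less_top]
      by (intro integrableI_nonneg) auto
    show "(LINT z|circle_measure. (cmod (f z - F n z))\<^sup>2) \<le> e\<^sup>2"
      using fatou[OF that] nn_integral_eq_integral[OF *] by (simp add: ennreal_le_iff)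
  qed
  have Cau: "\<exists>N. \<forall>n\<ge>N. \<forall>m\<ge>N. dist (X m) (X n) < e" if "e > 0" for e
    using metric_CauchyD[OF X that] by blast
  obtain N where N: "\<And>m. m \<ge> N \<Longrightarrow> dist (X m) (X N) < 1"
    using Cau[of 1] by auto
  have "square_integrable (\<lambda>z. f z - F N z)"
    unfolding square_integrable_def using int[OF N] by auto
  from square_integrable_add[OF this square_integrable_rep[of "X N"]]
  have f: "square_integrable f" by (simp add: F_def)
  have "X \<longlonglongrightarrow> abs_L2 f"
  proof (rule metric_LIMSEQ_I)
    fix e :: real assume e: "e > 0"
    obtain N where N: "\<And>m n. n \<ge> N \<Longrightarrow> m \<ge> N \<Longrightarrow> dist (X m) (X n) < e / 2"
      using Cau[of "e / 2"] e by auto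
    have "dist (X n) (abs_L2 f) < e" if n: "n \<ge> N" for n
    proof -
      have "(norm (abs_L2 f - X n))\<^sup>2 = (LINT z|circle_measure. (cmod (f z - F n z))\<^sup>2)"
        unfolding norm_L2_power2
      proof (rule integral_cong_AE)
        show "AE z in circle_measure. (cmod (rep_L2 (abs_L2 f - X n) z))\<^sup>2 = (cmod (f z - F n z))\<^sup>2"
          using rep_diff[of "abs_L2 f" "X n"] rep_abs_L2[OF f]
          by eventually_elim (simp add: F_def)
      qed measurable
      also have "\<dots> \<le> (e/2)\<^sup>2" by (rule le[OF N[OF n]])
      finally have "norm (abs_L2 f - X n) \<le> e/2" 
        by (rule power2_le_imp_le) (use e in simp)
      then show ?thesis using e unfolding dist_norm norm_minus_commute[of "X n"] by linarith
    qed
    then show "\<exists>N. \<forall>n\<ge>N. dist (X n) (abs_L2 f) < e" by blast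
  qed
  then show "convergent X" by (auto simp: convergent_def)
qed

section \<open>Boundary values of inner functions\<close>

text \<open>A dilate with \<open>r < 1\<close> is continuous up to the unit circle, which makes it
  measurable there and admits the mean value property.\<close>

lemma continuous_on_dilate:
  assumes "u holomorphic_on ball 0 1" "0 \<le> r" "r < 1"
  shows "continuous_on (cball 0 1) (\<lambda>z. u (of_real r * z))"
proof (rule continuous_on_compose2[OF holomorphic_on_imp_continuous_on[OF assms(1)]])
  show "(\<lambda>z. complex_of_real r * z) ` cball 0 1 \<subseteq> ball 0 1"
    using assms mult_left_le[of _ r] by (force simp: norm_mult)
qed (intro continuous_intros)

text \<open>Cauchy's criterion with both thresholds taken from sequences, so that the outer
  quantifiers are countable. The quantifiers over \<open>r\<close> and \<open>s\<close> stay
  uncountable; with the non-strict \<open>\<le>\<close> they cut out intersections of closed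
  sets.\<close>

lemma radial_limit_iff:
  fixes z :: complex
  shows "(\<exists>l::complex. ((\<lambda>r. u (of_real r * z)) \<longlongrightarrow> l) (at_left (1::real))) \<longleftrightarrow>
    (\<forall>n::nat. \<exists>m::nat. \<forall>r\<in>{1 - 1 / real (Suc m)<..<1}. \<forall>s\<in>{1 - 1 / real (Suc m)<..<1}.
       dist (u (of_real r * z)) (u (of_real s * z)) \<le> 1 / real (Suc n))" (is "?L \<longleftrightarrow> ?R")
proof -
  let ?f = "\<lambda>r. u (of_real r * z)"
  have "?L \<longleftrightarrow> cauchy_filter (filtermap ?f (at_left 1))"
  proof
    assume ?L
    then show "cauchy_filter (filtermap ?f (at_left 1))"
      unfolding filterlim_def using nhds_imp_cauchy_filter by blast
  next
    assume "cauchy_filter (filtermap ?f (at_left 1))"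
    moreover have "filtermap ?f (at_left 1) \<noteq> bot"
      by (simp add: filtermap_bot_iff)
    ultimately show ?L
      using complete_UNIV[where 'a = complex] unfolding complete_uniform filterlim_def by auto
  qed
  also have "\<dots> \<longleftrightarrow> ?R"
    unfolding cauchy_filter_metric_filtermap
  proof (intro iffI allI impI)
    fix n :: nat
    assume "\<forall>e>0. \<exists>P. eventually P (at_left 1) \<and> (\<forall>r s. P r \<and> P s \<longrightarrow> dist (?f r) (?f s) < e)"
    then obtain P where P: "eventually P (at_left (1::real))"
        "\<And>r s. P r \<Longrightarrow> P s \<Longrightarrow> dist (?f r) (?f s) < 1 / real (Suc n)"
      by (metis of_nat_0_less_iff zero_less_Suc zero_less_divide_1_iff)
    then obtain b where b: "b < 1" "\<And>y. b < y \<Longrightarrow> y < 1 \<Longrightarrow> P y"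
      unfolding eventually_at_left_field by auto
    obtain m where "1 / real (Suc m) < 1 - b"
      using nat_approx_posE[of "1 - b"] b(1) by auto
    then show "\<exists>m::nat. \<forall>r\<in>{1 - 1 / real (Suc m)<..<1}. \<forall>s\<in>{1 - 1 / real (Suc m)<..<1}.
       dist (?f r) (?f s) \<le> 1 / real (Suc n)"
      using P(2) b(2) by (intro exI[of _ m] ballI less_imp_le P(2)) auto
  next
    fix e :: real
    assume R: ?R and "e > 0"
    obtain n where n: "1 / real (Suc n) < e"
      using nat_approx_posE[OF \<open>e > 0\<close>] by blast
    obtain m :: nat where m: "\<And>r s. r\<in>{1 - 1 / real (Suc m)<..<1} \<Longrightarrow> s\<in>{1 - 1 / real (Suc m)<..<1} \<Longrightarrow>
       dist (?f r) (?f s) \<le> 1 / real (Suc n)"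
      using R by blast
    have "eventually (\<lambda>r. r \<in> {1 - 1 / real (Suc m)<..<1}) (at_left 1)"
      by (rule eventually_at_leftI[of "1 - 1 / real (Suc m)"]) auto
    moreover have "dist (?f r) (?f s) < e"
      if "r \<in> {1 - 1 / real (Suc m)<..<1}" "s \<in> {1 - 1 / real (Suc m)<..<1}" for r s
      using m[OF that] n by linarith
    ultimately show "\<exists>P. eventually P (at_left 1) \<and> (\<forall>r s. P r \<and> P s \<longrightarrow> dist (?f r) (?f s) < e)"
      by (intro exI[of _ "\<lambda>r. r \<in> {1 - 1 / real (Suc m)<..<1}"]) blast
  qed
  finally show ?thesis .
qed

text \<open>Pointwise limits of measurable functions and dominated convergence work along sequences,
  so these radii stand in for the filter \<open>at_left 1\<close>.\<close>

lemma radii: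
  defines "r \<equiv> \<lambda>n. 1 - 1 / real (Suc (Suc n))"
  shows "0 \<le> r n" "r n < 1" "filterlim r (at_left 1) sequentially"
proof -
  show "r n < 1" for n by (simp add: r_def)
  moreover have "(\<lambda>n. 1 - 1 / real (Suc (Suc n))) \<longlonglongrightarrow> 1 - 0"
    by (intro tendsto_diff tendsto_const LIMSEQ_Suc lim_1_over_n)
  ultimately show "filterlim r (at_left 1) sequentially"
    unfolding filterlim_at r_def by auto
  show "0 \<le> r n" by (simp add: r_def)
qed

text \<open>The set \<open>E\<close> where the radial limit exists is a countable intersection of
  countable unions of closed sets. On \<open>E\<close> the boundary function is the limit of dilates
  along the radii, and off \<open>E\<close> it is constant.\<close>

lemma boundary_measurable:
  assumes u: "u holomorphic_on ball 0 1"
  shows "boundary u \<in> borel_measurable circle_measure"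
proof -
  define I where "I m = {1 - 1 / real (Suc m)<..<(1::real)}" for m
  define S where "S m n = {z \<in> sphere 0 1. \<forall>r\<in>I m. \<forall>s\<in>I m.
    dist (u (of_real r * z)) (u (of_real s * z)) \<le> 1 / real (Suc n)}" for m n
  define E where "E = (\<Inter>n. \<Union>m. S m n)"
  have I: "0 \<le> r" "r < 1" if "r \<in> I m" for r m
  proof -
    have "1 / real (Suc m) \<le> 1" by simp
    with that show "0 \<le> r" "r < 1" unfolding I_def greaterThanLessThan_iff by linarith+
  qed
  have cont: "continuous_on (sphere 0 1) (\<lambda>z. u (of_real r * z))" if "0 \<le> r" "r < 1" for r
    by (rule continuous_on_subset[OF continuous_on_dilate[OF u that]]) auto
  have "closed (S m n)" for m n
  proof -
    \<comment> \<open>A witness that \<open>I m\<close> is non-empty: intersections over an empty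
      index set would be the whole plane and lose the condition
      \<open>z \<in> sphere 0 1\<close>.\<close>
    have "1 - 1 / (2 * real (Suc m)) \<in> I m" by (auto simp: I_def field_simps)
    then have "S m n = (\<Inter>r\<in>I m. \<Inter>s\<in>I m. {z \<in> sphere 0 1.
        dist (u (of_real r * z)) (u (of_real s * z)) \<le> 1 / real (Suc n)})"
      unfolding S_def by blast
    also have "closed \<dots>"
      by (intro closed_INT ballI continuous_on_closed_Collect_le continuous_on_dist cont
          continuous_on_const closed_sphere I)
    finally show ?thesis .
  qed
  then have E: "E \<in> sets borel" unfolding E_def by auto
  have iff: "z \<in> E \<longleftrightarrow> (\<exists>l. ((\<lambda>r. u (of_real r * z)) \<longlongrightarrow> l) (at_left (1::real)))"
    if "z \<in> sphere 0 1" for z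
    unfolding radial_limit_iff using that by (simp add: E_def S_def I_def)
  define r where "r n = 1 - 1 / real (Suc (Suc n))" for n
  note r = radii[folded r_def]
  \<comment> \<open>The value of \<open>Lim\<close> at a point without radial limit, where its
    definite description ranges over a predicate that is never satisfied.\<close>
  define c where "c = (THE l::complex. False)"
  show ?thesis
  proof (rule borel_measurable_LIMSEQ_metric)
    show "(\<lambda>z. if z \<in> E then u (of_real (r n) * z) else c) \<in> borel_measurable circle_measure" for n
    proof (rule measurable_If_set)
      show "E \<inter> space circle_measure \<in> sets circle_measure"
        using E by (auto simp: sets_restrict_space)
    qed (use cont r in \<open>auto intro: circle_borel_continuous\<close>)
    fix z assume z: "z \<in> space circle_measure"
    show "(\<lambda>n. if z \<in> E then u (of_real (r n) * z) else c) \<longlonglongrightarrow> boundary u z"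
    proof (cases "z \<in> E")
      case True
      then obtain l where l: "((\<lambda>r. u (of_real r * z)) \<longlongrightarrow> l) (at_left (1::real))"
        using iff z by auto
      then have "boundary u z = l"
        unfolding boundary_def by (intro tendsto_Lim) auto
      moreover have "(\<lambda>n. u (of_real (r n) * z)) \<longlonglongrightarrow> l"
        by (rule filterlim_compose[OF l r(3)])
      ultimately show ?thesis using True by simp
    next
      case False
      then have "boundary u z = c"
        using iff z unfolding boundary_def Topological_Spaces.Lim_def c_def
        by (intro arg_cong[where f = The] ext) auto
      then show ?thesis using False by simp
    qed
  qed
qed

lemma boundary_radial_limit:
  assumes "inner_function u"
  shows "AE z in circle_measure. ((\<lambda>r. u (of_real r * z)) \<longlongrightarrow> boundary u z) (at_left (1::real)) \<and>
    cmod (boundary u z) = 1"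
proof -
  have "AE z in circle_measure. \<exists>l. ((\<lambda>r. u (of_real r * z)) \<longlongrightarrow> l) (at_left (1::real)) \<and> cmod l = 1"
    using assms by (simp add: inner_function_def)
  then show ?thesis
  proof eventually_elim
    case (elim z)
    then obtain l where l: "((\<lambda>r. u (of_real r * z)) \<longlongrightarrow> l) (at_left (1::real))" "cmod l = 1"
      by blast
    have "boundary u z = l"
      unfolding boundary_def by (intro tendsto_Lim l) auto
    with l show ?case by simp
  qed
qed

text \<open>Evaluate \<open>u (r * z) * z ^ k\<close> at the centre for \<open>r < 1\<close>, then
  let \<open>r\<close> tend to 1, with the bound on \<open>u\<close> as majorant. In Fourier terms
  the boundary function has no negative modes and has mean \<open>u 0\<close>.\<close>

lemma boundary_moments:
  assumes u: "inner_function u"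
  shows "(LINT z|circle_measure. boundary u z * z ^ k) = (if k = 0 then u 0 else 0)"
proof -
  interpret prob_space circle_measure by (rule prob_space_circle_measure)
  have hol: "u holomorphic_on ball 0 1" and "bounded (u ` ball 0 1)"
    using u by (auto simp: inner_function_def)
  then obtain B where B: "\<And>w. cmod w < 1 \<Longrightarrow> cmod (u w) \<le> B"
    unfolding bounded_iff by (metis imageI mem_ball_0)
  define r where "r n = 1 - 1 / real (Suc (Suc n))" for n
  note r = radii[folded r_def]
  note [measurable] = boundary_measurable[OF hol]
  have [measurable]: "(\<lambda>z. z ^ k) \<in> borel_measurable circle_measure" for k
    by (intro circle_borel_continuous continuous_intros)
  have [measurable]: "(\<lambda>z. u (of_real (r n) * z)) \<in> borel_measurable circle_measure" for n
    by (intro circle_borel_continuous continuous_on_subset[OF continuous_on_dilate[OF hol r(1,2)]]) auto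
  have "(\<lambda>n. LINT z|circle_measure. u (of_real (r n) * z) * z ^ k) \<longlonglongrightarrow>
      (LINT z|circle_measure. boundary u z * z ^ k)"
  proof (rule integral_dominated_convergence)
    show "integrable circle_measure (\<lambda>_. B)" by simp
    show "AE z in circle_measure. (\<lambda>n. u (of_real (r n) * z) * z ^ k) \<longlonglongrightarrow> boundary u z * z ^ k"
      using boundary_radial_limit[OF u]
    proof eventually_elim
      case (elim z)
      then show ?case
        by (intro tendsto_intros filterlim_compose[OF _ r(3)]) auto
    qed
    show "AE z in circle_measure. norm (u (of_real (r n) * z) * z ^ k) \<le> B" for n
      using r(1,2)[of n] by (intro AE_in_circle) (auto simp: norm_mult norm_power intro!: B)
  qed measurable
  moreover have "(LINT z|circle_measure. u (of_real (r n) * z) * z ^ k) = (if k = 0 then u 0 else 0)" for n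
  proof -
    have "(LINT z|circle_measure. u (of_real (r n) * z) * z ^ k) = u (of_real (r n) * 0) * 0 ^ k"
    proof (rule circle_mean_value)
      show "continuous_on (cball 0 1) (\<lambda>z. u (of_real (r n) * z) * z ^ k)"
        by (intro continuous_intros continuous_on_dilate[OF hol r(1,2)])
      have "(\<lambda>z. u (of_real (r n) * z)) holomorphic_on ball 0 1"
      proof (rule holomorphic_on_compose_gen[OF _ hol, unfolded o_def])
        have "cmod (of_real (r n) * z) < 1" if "cmod z < 1" for z
        proof -
          have "cmod (of_real (r n) * z) \<le> cmod z"
            using r(1,2)[of n] by (simp add: norm_mult mult_left_le_one_le)
          with that show ?thesis by simp
        qed
        then show "(\<lambda>z. complex_of_real (r n) * z) ` ball 0 1 \<subseteq> ball 0 1" by auto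
      qed (intro holomorphic_intros)
      then show "(\<lambda>z. u (of_real (r n) * z) * z ^ k) holomorphic_on ball 0 1"
        by (intro holomorphic_intros)
    qed
    then show ?thesis by (simp add: power_0_left)
  qed
  ultimately show ?thesis by (simp add: LIMSEQ_const_iff)
qed

section \<open>Multiplication operators and Fourier coefficients\<close>

lemma cnj_powi_circle: "cmod z = 1 \<Longrightarrow> cnj z powi n = z powi (-n)"
  by (metis inverse_eq_cnj_circle power_int_inverse power_int_minus)

lemma powi_add_circle: "cmod z = 1 \<Longrightarrow> z powi (m + n) = z powi m * z powi n"
  by (rule power_int_add) auto

lemma rep_add: "AE z in circle_measure. rep_L2 (f + g) z = rep_L2 f z + rep_L2 g z"
  using rep_abs_L2[OF square_integrable_add[OF square_integrable_rep[of f] square_integrable_rep[of g]]]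
    plus_L2.abs_eq[of "rep_L2 f" "rep_L2 g"]
  by (simp add: abs_rep_L2 eq_ae_def square_integrable_rep)

lemma rep_cscale: "AE z in circle_measure. rep_L2 (cscale c f) z = c * rep_L2 f z"
  using rep_abs_L2[OF square_integrable_scale[OF square_integrable_rep[of f]]]
    cscale.abs_eq[of "rep_L2 f" c]
  by (simp add: abs_rep_L2 eq_ae_def square_integrable_rep)

lemma rep_cnj: "AE z in circle_measure. rep_L2 (cnj_L2 f) z = cnj (rep_L2 f z)"
  using rep_abs_L2[OF square_integrable_cnj[OF square_integrable_rep[of f]]]
    cnj_L2.abs_eq[of "rep_L2 f"]
  by (simp add: abs_rep_L2 eq_ae_def square_integrable_rep)

lemma rep_mult:
  assumes "\<phi> \<in> L_inf"
  shows "AE z in circle_measure. rep_L2 (mult_L2 \<phi> f) z = \<phi> z * rep_L2 f z"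
  using rep_abs_L2[OF square_integrable_mult[OF assms square_integrable_rep[of f]]]
    mult_L2.abs_eq[of "rep_L2 f" \<phi>] assms
  by (simp add: abs_rep_L2 eq_ae_def square_integrable_rep)

lemma L_inf_measurable: "\<phi> \<in> L_inf \<Longrightarrow> \<phi> \<in> borel_measurable circle_measure"
  by (simp add: L_inf_def)

lemma L_inf_cnj: "\<phi> \<in> L_inf \<Longrightarrow> (\<lambda>z. cnj (\<phi> z)) \<in> L_inf"
  by (auto simp: L_inf_def)

lemma L_inf_unimodular:
  "\<phi> \<in> borel_measurable circle_measure \<Longrightarrow> AE z in circle_measure. cmod (\<phi> z) = 1 \<Longrightarrow> \<phi> \<in> L_inf"
  by (auto simp: L_inf_def intro!: exI[of _ 1] elim: eventually_mono)

lemma powi_L_inf [simp]: "(\<lambda>z. z powi n) \<in> L_inf"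
  by (rule L_inf_unimodular[OF power_int_borel_measurable]) (auto simp: norm_power_int)

lemma id_L_inf [simp]: "(\<lambda>z. z) \<in> L_inf"
  using powi_L_inf[of 1] by simp

lemma indicator_L_inf: "A \<in> sets circle_measure \<Longrightarrow> indicator A \<in> L_inf"
  by (auto simp: L_inf_def intro!: exI[of _ 1] split: split_indicator)

lemma mult_L2_add: "mult_L2 \<phi> (f + g) = mult_L2 \<phi> f + mult_L2 \<phi> g"
proof (cases "\<phi> \<in> L_inf")
  case True
  show ?thesis
  proof (rule L2_eqI)
    show "AE z in circle_measure. rep_L2 (mult_L2 \<phi> (f + g)) z = rep_L2 (mult_L2 \<phi> f + mult_L2 \<phi> g) z"
      using rep_mult[OF True, of f] rep_mult[OF True, of g] rep_mult[OF True, of "f + g"]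
        rep_add[of f g] rep_add[of "mult_L2 \<phi> f" "mult_L2 \<phi> g"]
      by eventually_elim (simp add: distrib_left)
  qed
next
  \<comment> \<open>By the dummy convention in \<open>mult_L2\<close>, such a symbol acts as the
    zero operator.\<close>
  case False
  then show ?thesis
    by transfer (auto simp: eq_ae_def square_integrable_zero)
qed

lemma mult_L2_cscale: "mult_L2 \<phi> (cscale c f) = cscale c (mult_L2 \<phi> f)"
proof (cases "\<phi> \<in> L_inf")
  case True
  show ?thesis
  proof (rule L2_eqI)
    show "AE z in circle_measure. rep_L2 (mult_L2 \<phi> (cscale c f)) z = rep_L2 (cscale c (mult_L2 \<phi> f)) z"
      using rep_mult[OF True, of f] rep_mult[OF True, of "cscale c f"] rep_cscale[of c f]
        rep_cscale[of c "mult_L2 \<phi> f"]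
      by eventually_elim simp
  qed
next
  case False
  then show ?thesis
    by transfer (auto simp: eq_ae_def square_integrable_zero)
qed

lemma cscale_minus_one: "cscale (-1) f = - f"
  by (metis L2.scale_minus_left L2.scale_one)

lemma mult_L2_minus: "mult_L2 \<phi> (- f) = - mult_L2 \<phi> f"
  by (metis cscale_minus_one mult_L2_cscale)

lemma mult_L2_diff: "mult_L2 \<phi> (f - g) = mult_L2 \<phi> f - mult_L2 \<phi> g"
  using mult_L2_add[of \<phi> f "-g"] by (simp add: mult_L2_minus)

lemma mult_L2_zero: "mult_L2 \<phi> 0 = 0"
  using mult_L2_diff[of \<phi> 0 0] by simp

lemma mult_L2_cong_AE:
  assumes "\<phi> \<in> L_inf" "\<psi> \<in> L_inf" "AE z in circle_measure. \<phi> z = \<psi> z"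
  shows "mult_L2 \<phi> f = mult_L2 \<psi> f"
proof (rule L2_eqI)
  show "AE z in circle_measure. rep_L2 (mult_L2 \<phi> f) z = rep_L2 (mult_L2 \<psi> f) z"
    using assms(3) rep_mult[OF assms(1), of f] rep_mult[OF assms(2), of f]
    by eventually_elim simp
qed

lemma mult_L2_mult_AE:
  assumes "\<phi> \<in> L_inf" "\<psi> \<in> L_inf" "\<theta> \<in> L_inf" "AE z in circle_measure. \<theta> z = \<phi> z * \<psi> z"
  shows "mult_L2 \<phi> (mult_L2 \<psi> f) = mult_L2 \<theta> f"
proof (rule L2_eqI)
  show "AE z in circle_measure. rep_L2 (mult_L2 \<phi> (mult_L2 \<psi> f)) z = rep_L2 (mult_L2 \<theta> f) z"
    using assms(4) rep_mult[OF assms(1), of "mult_L2 \<psi> f"] rep_mult[OF assms(2), of f]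
      rep_mult[OF assms(3), of f]
    by eventually_elim simp
qed

lemma mult_L2_one: "mult_L2 (\<lambda>_. 1) f = f"
  using rep_mult[OF const_in_L_inf, of 1 f] by (intro L2_eqI) simp

lemma mult_L2_commute:
  assumes "\<phi> \<in> L_inf" "\<psi> \<in> L_inf"
  shows "mult_L2 \<phi> (mult_L2 \<psi> f) = mult_L2 \<psi> (mult_L2 \<phi> f)"
proof (rule L2_eqI)
  show "AE z in circle_measure. rep_L2 (mult_L2 \<phi> (mult_L2 \<psi> f)) z =
      rep_L2 (mult_L2 \<psi> (mult_L2 \<phi> f)) z"
    using rep_mult[OF assms(1), of "mult_L2 \<psi> f"] rep_mult[OF assms(2), of f]
      rep_mult[OF assms(2), of "mult_L2 \<phi> f"] rep_mult[OF assms(1), of f]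
    by eventually_elim simp
qed

text \<open>A unimodular symbol acts unitarily, with the conjugate symbol as inverse; this turns
  images of \<open>H2\<close> under such multiplications into preimages.\<close>

lemma mult_L2_cnj_unimodular:
  assumes "\<phi> \<in> L_inf" "AE z in circle_measure. cmod (\<phi> z) = 1"
  shows "mult_L2 (\<lambda>z. cnj (\<phi> z)) (mult_L2 \<phi> f) = f" "mult_L2 \<phi> (mult_L2 (\<lambda>z. cnj (\<phi> z)) f) = f"
proof -
  have "AE z in circle_measure. 1 = cnj (\<phi> z) * \<phi> z"
    using assms(2) by eventually_elim
      (metis complex_norm_square mult.commute of_real_1 one_power2)
  from mult_L2_mult_AE[OF L_inf_cnj[OF assms(1)] assms(1) const_in_L_inf this, of f]
  show "mult_L2 (\<lambda>z. cnj (\<phi> z)) (mult_L2 \<phi> f) = f" by (simp add: mult_L2_one)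
  then show "mult_L2 \<phi> (mult_L2 (\<lambda>z. cnj (\<phi> z)) f) = f"
    using mult_L2_commute[OF assms(1) L_inf_cnj[OF assms(1)]] by simp
qed

lemma mult_powi_powi: "mult_L2 (\<lambda>z. z powi m) (mult_L2 (\<lambda>z. z powi n) f) = mult_L2 (\<lambda>z. z powi (m + n)) f"
  by (rule mult_L2_mult_AE) (auto intro!: AE_in_circle simp: powi_add_circle)

lemma mult_id_eq_powi: "mult_L2 (\<lambda>z. z) = mult_L2 (\<lambda>z. z powi 1)"
  by simp

section \<open>Adjoints, boundedness and orthogonal projections\<close>

lemma cinner_mult_left:
  assumes "\<phi> \<in> L_inf"
  shows "cinner (mult_L2 \<phi> f) g = cinner f (mult_L2 (\<lambda>z. cnj (\<phi> z)) g)"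
  unfolding cinner_rep
proof (rule integral_cong_AE)
  show "AE z in circle_measure. rep_L2 (mult_L2 \<phi> f) z * cnj (rep_L2 g z) =
      rep_L2 f z * cnj (rep_L2 (mult_L2 (\<lambda>z. cnj (\<phi> z)) g) z)"
    using rep_mult[OF assms, of f] rep_mult[OF L_inf_cnj[OF assms], of g]
    by eventually_elim simp
qed measurable

lemma cinner_powi_left:
  "cinner (mult_L2 (\<lambda>z. z powi n) f) g = cinner f (mult_L2 (\<lambda>z. z powi (-n)) g)"
proof -
  have "(\<lambda>z. cnj (z powi n)) \<in> L_inf" by (rule L_inf_cnj) simp
  then show ?thesis
    by (simp add: cinner_mult_left) (intro arg_cong2[where f = cinner] mult_L2_cong_AE refl,
      auto intro!: AE_in_circle simp: cnj_powi_circle)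
qed

lemma cinner_zero_left [simp]: "cinner 0 g = 0"
  using cinner_scale_left[of 0 0 g] by (simp add: L2.scale_zero_left)

lemma cinner_zero_commute: "cinner f g = 0 \<longleftrightarrow> cinner g f = 0"
  by (metis cinner_commute complex_cnj_zero_iff)

lemma cinner_minus_left: "cinner (- f) g = - cinner f g"
  using cinner_scale_left[of "-1" f g] by (simp add: cscale_minus_one)

lemma cinner_diff_left: "cinner (f - g) h = cinner f h - cinner g h"
  using cinner_add_left[of f "-g" h] by (simp add: cinner_minus_left)

lemma cinner_diff_right: "cinner h (f - g) = cinner h f - cinner h g"
  by (metis cinner_commute cinner_diff_left complex_cnj_diff)

lemma cinner_scale_right: "cinner f (cscale c g) = cnj c * cinner f g"
  by (metis cinner_commute cinner_scale_left complex_cnj_mult)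

text \<open>The imaginary part of \<open>cinner f g\<close> is the real inner product of
  \<open>f\<close> with \<open>\<i>\<close> times \<open>g\<close>, so continuity of the real inner
  product suffices.\<close>

lemma continuous_on_cinner: "continuous_on UNIV (\<lambda>f. cinner f g)"
proof -
  have "cinner f g = Complex (inner f g) (inner f (cscale \<i> g))" for f
    by (simp add: inner_L2_def cinner_scale_right complex_eq_iff)
  then show ?thesis
    by (simp add: Complex_eq) (intro continuous_intros)
qed

lemma norm_mult_L2_le:
  assumes "\<phi> \<in> L_inf" "AE z in circle_measure. cmod (\<phi> z) \<le> C" "C \<ge> 0"
  shows "norm (mult_L2 \<phi> f) \<le> C * norm f"
proof (rule power2_le_imp_le)
  have "(norm (mult_L2 \<phi> f))\<^sup>2 \<le> (LINT z|circle_measure. C\<^sup>2 * (cmod (rep_L2 f z))\<^sup>2)"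
    unfolding norm_L2_power2
  proof (rule integral_mono_AE)
    show "AE z in circle_measure. (cmod (rep_L2 (mult_L2 \<phi> f) z))\<^sup>2 \<le> C\<^sup>2 * (cmod (rep_L2 f z))\<^sup>2"
      using assms(2) rep_mult[OF assms(1), of f]
    proof eventually_elim
      case (elim z)
      then have "(cmod (rep_L2 (mult_L2 \<phi> f) z))\<^sup>2 \<le> (C * cmod (rep_L2 f z))\<^sup>2"
        using mult_right_mono[of "cmod (\<phi> z)" C "cmod (rep_L2 f z)"]
        by (intro power_mono) (simp_all add: norm_mult)
      then show ?case by (simp add: power_mult_distrib)
    qed
  qed (use square_integrable_rep in \<open>auto simp: square_integrable_def\<close>)
  then show "(norm (mult_L2 \<phi> f))\<^sup>2 \<le> (C * norm f)\<^sup>2"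
    by (simp add: norm_L2_power2 power_mult_distrib)
qed (use assms(3) in simp)

lemma bounded_linear_mult_L2:
  assumes "\<phi> \<in> L_inf"
  shows "bounded_linear (mult_L2 \<phi>)"
proof -
  obtain C where "AE z in circle_measure. cmod (\<phi> z) \<le> C"
    using assms by (auto simp: L_inf_def)
  then have "AE z in circle_measure. cmod (\<phi> z) \<le> \<bar>C\<bar>"
    by eventually_elim simp
  from norm_mult_L2_le[OF assms this] show ?thesis
    by (intro bounded_linear_intro[where K = "\<bar>C\<bar>"])
       (simp_all add: mult_L2_add scaleR_L2_def mult_L2_cscale mult.commute)
qed

lemma subspace_imp_real_subspace: "L2.subspace M \<Longrightarrow> subspace M"
  by (auto simp: L2.subspace_def subspace_def scaleR_L2_def)

lemma subspace_vimage_mult_L2: "L2.subspace M \<Longrightarrow> L2.subspace {f. mult_L2 \<phi> f \<in> M}"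
  by (auto simp: L2.subspace_def mult_L2_add mult_L2_cscale mult_L2_zero)

lemma closed_vimage_mult_L2: "closed M \<Longrightarrow> \<phi> \<in> L_inf \<Longrightarrow> closed {f. mult_L2 \<phi> f \<in> M}"
  using closed_vimage[of M "mult_L2 \<phi>"] linear_continuous_on[OF bounded_linear_mult_L2]
  by (simp add: vimage_def)

lemma subspace_ortho_complement: "L2.subspace (ortho_complement M)"
  by (auto simp: L2.subspace_def ortho_complement_def cinner_add_left cinner_scale_left)

lemma closed_ortho_complement: "closed (ortho_complement M)"
proof -
  have "ortho_complement M = (\<Inter>g\<in>M. (\<lambda>f. cinner f g) -` {0})"
    by (auto simp: ortho_complement_def)
  then show ?thesis
    by (simp only:) (intro closed_INT ballI closed_vimage closed_singleton continuous_on_cinner)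
qed

lemma ortho_complement_disjoint: "f \<in> M \<Longrightarrow> f \<in> ortho_complement M \<Longrightarrow> f = 0"
  using cinner_self_eq_0[of f] by (auto simp: ortho_complement_def)

text \<open>Two candidates differ by a vector that is both in \<open>M\<close> and orthogonal to
  \<open>M\<close>. Projections can therefore be computed by exhibiting a decomposition.\<close>

lemma ortho_proj_eqI:
  assumes "L2.subspace M" "g \<in> M" "f - g \<in> ortho_complement M"
  shows "ortho_proj M f = g"
  unfolding ortho_proj_def
proof (rule the_equality)
  fix h assume h: "h \<in> M \<and> f - h \<in> ortho_complement M"
have "(f - g) - (f - h) \<in> ortho_complement M"
    using L2.subspace_diff[OF subspace_ortho_complement assms(3)] h by blast
  moreover have "h - g \<in> M" using assms h by (intro L2.subspace_diff) auto
  ultimately have "h - g = 0" by (intro ortho_complement_disjoint) auto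
  then show "h = g" by simp
qed (use assms in auto)

text \<open>Testing real orthogonality with both \<open>m\<close> and \<open>\<i>\<close> times
  \<open>m\<close>, which stays in the complex subspace, kills the real and the imaginary part of
  \<open>cinner\<close>.\<close>

lemma ortho_proj:
  assumes M: "L2.subspace M" "closed M"
  shows "ortho_proj M f \<in> M" "f - ortho_proj M f \<in> ortho_complement M"
proof -
  obtain p where p: "p \<in> M" "\<And>m. m \<in> M \<Longrightarrow> inner (f - p) m = 0"
    using closed_subspace_projection[OF subspace_imp_real_subspace[OF M(1)] M(2)] by metis
  have "cinner (f - p) m = 0" if "m \<in> M" for m
    using p(2)[OF that] p(2)[OF L2.subspace_scale[OF M(1) that, of \<i>]]
    by (simp add: inner_L2_def cinner_scale_right complex_eq_iff)
  then have "f - p \<in> ortho_complement M" by (simp add: ortho_complement_def)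
  with p(1) ortho_proj_eqI[OF M(1) p(1) this]
  show "ortho_proj M f \<in> M" "f - ortho_proj M f \<in> ortho_complement M" by simp_all
qed

section \<open>Monomials and Fourier coefficients\<close>

lemma square_integrable_powi: "square_integrable (\<lambda>z. z powi n)"
proof -
  interpret prob_space circle_measure by (rule prob_space_circle_measure)
  have "square_integrable (\<lambda>_. 1)" by (simp add: square_integrable_def)
  from square_integrable_mult[OF powi_L_inf this] show ?thesis by simp
qed

lift_definition zpow :: "int \<Rightarrow> L2" is "\<lambda>n z. z powi n"
  by (simp add: eq_ae_def square_integrable_powi)

lemma rep_zpow: "AE z in circle_measure. rep_L2 (zpow n) z = z powi n"
  using rep_abs_L2[OF square_integrable_powi] by (simp add: zpow_def)

lemma fourier_coeff_eq_cinner: "fourier_coeff f n = cinner f (zpow n)"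
  by transfer (auto intro!: Bochner_Integration.integral_cong simp: cnj_powi_circle)

lemma mult_powi_zpow: "mult_L2 (\<lambda>z. z powi m) (zpow n) = zpow (m + n)"
proof (rule L2_eqI)
  have "AE z in circle_measure. z powi (m + n) = z powi m * z powi n"
    by (intro AE_in_circle powi_add_circle) auto
  then show "AE z in circle_measure. rep_L2 (mult_L2 (\<lambda>z. z powi m) (zpow n)) z = rep_L2 (zpow (m + n)) z"
    using rep_mult[OF powi_L_inf, of m "zpow n"] rep_zpow[of n] rep_zpow[of "m + n"]
    by eventually_elim simp
qed

text \<open>The image of each monomial is a shift of the class of \<open>\<phi>\<close> itself, so
  in a shift invariant subspace a single vector controls the monomials.\<close>

lemma mult_zpow:
  assumes "\<phi> \<in> L_inf"
  shows "mult_L2 \<phi> (zpow n) = mult_L2 (\<lambda>z. z powi n) (mult_L2 \<phi> (zpow 0))"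
  using mult_L2_commute[OF assms powi_L_inf, of n "zpow 0"] by (simp only: mult_powi_zpow) simp

lemma cinner_mult_zpow:
  assumes "\<phi> \<in> L_inf"
  shows "cinner (mult_L2 \<phi> (zpow m)) (zpow n) = (LINT z|circle_measure. \<phi> z * z powi (m - n))"
  unfolding cinner_rep
proof (rule integral_cong_AE)
  have "AE z in circle_measure. z powi m * cnj (z powi n) = z powi (m - n)"
    by (rule AE_in_circle) (simp add: cnj_powi_circle flip: powi_add_circle)
  then show "AE z in circle_measure. rep_L2 (mult_L2 \<phi> (zpow m)) z * cnj (rep_L2 (zpow n) z) = \<phi> z * z powi (m - n)"
    using rep_mult[OF assms, of "zpow m"] rep_zpow[of m] rep_zpow[of n]
    by eventually_elim (simp add: mult.assoc)
qed (use L_inf_measurable[OF assms] power_int_borel_measurable in measurable)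

lemma fourier_coeff_zpow: "fourier_coeff (zpow m) n = (if m = n then 1 else 0)"
  using cinner_mult_zpow[OF const_in_L_inf, of 1 m n]
  by (simp add: fourier_coeff_eq_cinner mult_L2_one integral_circle_powi)

lemma fourier_coeff_shift: "fourier_coeff (mult_L2 (\<lambda>z. z powi m) f) n = fourier_coeff f (n - m)"
  by (simp add: fourier_coeff_eq_cinner cinner_powi_left mult_powi_zpow)

lemma fourier_coeff_add: "fourier_coeff (f + g) n = fourier_coeff f n + fourier_coeff g n"
  by (simp add: fourier_coeff_eq_cinner cinner_add_left)

lemma fourier_coeff_diff: "fourier_coeff (f - g) n = fourier_coeff f n - fourier_coeff g n"
  by (simp add: fourier_coeff_eq_cinner cinner_diff_left)

lemma fourier_coeff_cscale: "fourier_coeff (cscale c f) n = c * fourier_coeff f n"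
  by (simp add: fourier_coeff_eq_cinner cinner_scale_left)

text \<open>The inner products with the shifts are exactly the Fourier coefficients of the
  integrable product \<open>f * cnj g\<close>.\<close>

lemma shift_orthogonal_imp_AE_zero:
  assumes "\<And>n. cinner (mult_L2 (\<lambda>z. z powi n) f) g = 0"
  shows "AE z in circle_measure. rep_L2 f z * cnj (rep_L2 g z) = 0"
proof (rule fourier_zero_imp_AE_zero)
  show "integrable circle_measure (\<lambda>z. rep_L2 f z * cnj (rep_L2 g z))"
    by (intro integrable_mult_cnj square_integrable_rep)
  fix n
  note [measurable] = power_int_borel_measurable
  have "(LINT z|circle_measure. rep_L2 f z * cnj (rep_L2 g z) * z powi n) = cinner (mult_L2 (\<lambda>z. z powi n) f) g"
    unfolding cinner_rep
  proof (rule integral_cong_AE)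
    show "AE z in circle_measure. rep_L2 f z * cnj (rep_L2 g z) * z powi n =
        rep_L2 (mult_L2 (\<lambda>z. z powi n) f) z * cnj (rep_L2 g z)"
      using rep_mult[OF powi_L_inf, of n f] by eventually_elim simp
  qed measurable
  then show "(LINT z|circle_measure. rep_L2 f z * cnj (rep_L2 g z) * z powi n) = 0"
    using assms by simp
qed

lemma fourier_coeff_zero_imp_zero:
  assumes "\<And>n. fourier_coeff f n = 0"
  shows "f = 0"
proof -
  have "AE z in circle_measure. rep_L2 f z * cnj (rep_L2 (zpow 0) z) = 0"
    by (rule shift_orthogonal_imp_AE_zero)
      (simp add: cinner_powi_left mult_powi_zpow assms[unfolded fourier_coeff_eq_cinner])
  moreover have "AE z in circle_measure. rep_L2 0 z = (0::complex)"
    using rep_cscale[of 0 0] by (simp add: L2.scale_zero_left)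
  ultimately have "AE z in circle_measure. rep_L2 f z = rep_L2 0 z"
    using rep_zpow[of 0] by eventually_elim simp
  then show ?thesis by (rule L2_eqI)
qed

section \<open>The Hardy space, its orthogonal complement and the two projections\<close>

lemma H2_eq_ortho: "H2 = ortho_complement (zpow ` {..<0})"
  by (auto simp: H2_def ortho_complement_def fourier_coeff_eq_cinner)

lemma subspace_H2: "L2.subspace H2" and closed_H2: "closed H2"
  unfolding H2_eq_ortho by (rule subspace_ortho_complement closed_ortho_complement)+

lemma zpow_in_H2: "n \<ge> 0 \<Longrightarrow> zpow n \<in> H2"
  by (auto simp: H2_def fourier_coeff_zpow)

text \<open>Density of analytic polynomials in \<open>H2\<close>, phrased for reuse: a property that
  cuts out a closed subspace need only be checked on monomials.\<close>

lemma H2_subset: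
  assumes M: "L2.subspace M" "closed M" and z: "\<And>n. n \<ge> 0 \<Longrightarrow> zpow n \<in> M"
  shows "H2 \<subseteq> M"
proof
  fix h assume h: "h \<in> H2"
  \<comment> \<open>Intersecting with \<open>H2\<close> keeps the residual \<open>b\<close> in
    \<open>H2\<close>, so its negative coefficients vanish as well as the non-negative ones.\<close>
  define N where "N = M \<inter> H2"
  have N: "L2.subspace N" "closed N"
    unfolding N_def by (intro L2.subspace_inter M subspace_H2 closed_Int closed_H2)+
  note p = ortho_proj[OF N, of h]
  define b where "b = h - ortho_proj N h"
  have "b \<in> H2"
    unfolding b_def using p(1) by (intro L2.subspace_diff subspace_H2 h) (auto simp: N_def)
  moreover have "cinner b (zpow n) = 0" if "n \<ge> 0" for n
    using p(2) z[OF that] zpow_in_H2[OF that] by (auto simp: b_def ortho_complement_def N_def)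
  ultimately have "fourier_coeff b n = 0" for n
    by (cases "n \<ge> 0") (auto simp: H2_def fourier_coeff_eq_cinner)
  then have "b = 0" by (rule fourier_coeff_zero_imp_zero)
  then show "h \<in> M" using p(1) by (simp add: b_def N_def)
qed

lemma trig_dense:
  assumes M: "L2.subspace M" "closed M" and z: "\<And>n. zpow n \<in> M"
  shows "f \<in> M"
proof -
  note p = ortho_proj[OF M, of f]
  have "f - ortho_proj M f = 0"
    by (rule fourier_coeff_zero_imp_zero)
      (use p(2) z in \<open>auto simp: ortho_complement_def fourier_coeff_eq_cinner\<close>)
  then show ?thesis using p(1) by simp
qed

lemma ortho_complement_H2: "ortho_complement H2 = {f. \<forall>n\<ge>0. fourier_coeff f n = 0}"
proof (intro equalityI subsetI)
  fix f assume "f \<in> ortho_complement H2"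
  then show "f \<in> {f. \<forall>n\<ge>0. fourier_coeff f n = 0}"
    by (auto simp: ortho_complement_def fourier_coeff_eq_cinner zpow_in_H2)
next
  fix f assume f: "f \<in> {f. \<forall>n\<ge>0. fourier_coeff f n = 0}"
  have "H2 \<subseteq> ortho_complement {f}"
    by (rule H2_subset[OF subspace_ortho_complement closed_ortho_complement])
      (use f in \<open>auto simp: ortho_complement_def fourier_coeff_eq_cinner cinner_zero_commute[of "zpow _"]\<close>)
  then show "f \<in> ortho_complement H2"
    using cinner_zero_commute by (fastforce simp: ortho_complement_def)
qed

text \<open>A conjugate-linear involution that reflects the Fourier index \<open>n\<close> to
  \<open>- n - 1\<close> and so exchanges \<open>H2\<close> and \<open>conj_H2_0\<close>. Being an
  involution, it has equal images and preimages.\<close>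

definition flip :: "L2 \<Rightarrow> L2" where "flip f = cnj_L2 (mult_L2 (\<lambda>z. z) f)"

lemma rep_flip: "AE z in circle_measure. rep_L2 (flip f) z = cnj (z * rep_L2 f z)"
  using rep_cnj[of "mult_L2 (\<lambda>z. z) f"] rep_mult[OF id_L_inf, of f]
  unfolding flip_def by eventually_elim simp

lemma flip_flip: "flip (flip f) = f"
proof (rule L2_eqI)
  have "AE z in circle_measure. cnj z * z = 1"
    by (rule AE_in_circle) (metis complex_norm_square mult.commute of_real_1 one_power2)
  then show "AE z in circle_measure. rep_L2 (flip (flip f)) z = rep_L2 f z"
    using rep_flip[of f] rep_flip[of "flip f"]
    by eventually_elim (simp add: mult.assoc[symmetric])
qed

lemma fourier_coeff_flip: "fourier_coeff (flip f) n = cnj (fourier_coeff f (- n - 1))"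
  unfolding fourier_coeff_eq_cinner cinner_rep Bochner_Integration.integral_cnj[symmetric]
proof (rule integral_cong_AE)
  have "AE z in circle_measure. cnj z * cnj (z powi n) = z powi (- n - 1)"
  proof (rule AE_in_circle)
    fix z :: complex assume "cmod z = 1"
    then show "cnj z * cnj (z powi n) = z powi (- n - 1)"
      using cnj_powi_circle[of z n] cnj_powi_circle[of z 1] powi_add_circle[of z "- n" "- 1"]
      by simp
  qed
  then show "AE z in circle_measure. rep_L2 (flip f) z * cnj (rep_L2 (zpow n) z) =
      cnj (rep_L2 f z * cnj (rep_L2 (zpow (- n - 1)) z))"
    using rep_flip[of f] rep_zpow[of n] rep_zpow[of "- n - 1"]
    by eventually_elim (simp add: mult_ac)
qed measurable

lemma conj_H2_0_eq: "conj_H2_0 = {f. \<forall>n\<ge>0. fourier_coeff f n = 0}"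
proof -
  have "conj_H2_0 = flip ` H2" by (simp add: conj_H2_0_def flip_def)
  also have "\<dots> = {f. flip f \<in> H2}" by (metis (mono_tags) flip_flip image_iff mem_Collect_eq set_eqI)
  also have "\<dots> = {f. \<forall>n\<ge>0. fourier_coeff f n = 0}"
  proof (rule Collect_cong)
    fix f
    have "(\<forall>n<0. fourier_coeff f (- n - 1) = 0) \<longleftrightarrow> (\<forall>n\<ge>0. fourier_coeff f n = 0)"
      by (rule iffI; intro allI impI) (drule_tac x = "- n - 1" in spec, simp)+
    then show "flip f \<in> H2 \<longleftrightarrow> (\<forall>n\<ge>0. fourier_coeff f n = 0)"
      by (simp add: H2_def fourier_coeff_flip)
  qed
  finally show ?thesis .
qed

lemma conj_H2_0_eq_ortho: "conj_H2_0 = ortho_complement H2"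
  by (simp add: conj_H2_0_eq ortho_complement_H2)

lemma subspace_conj_H2_0: "L2.subspace conj_H2_0"
  unfolding conj_H2_0_eq_ortho by (rule subspace_ortho_complement)

text \<open>The second fact computes both projections from any splitting into the two orthogonal
  pieces, which makes their linearity a matter of splitting.\<close>

lemma P_split: "P_plus f \<in> H2" "P_minus f \<in> conj_H2_0" "P_plus f + P_minus f = f"
  and P_decompI: "a \<in> H2 \<Longrightarrow> b \<in> conj_H2_0 \<Longrightarrow> P_plus (a + b) = a \<and> P_minus (a + b) = b"
proof -
  show *: "P_plus (a + b) = a \<and> P_minus (a + b) = b" if "a \<in> H2" "b \<in> conj_H2_0" for a b
    unfolding P_plus_def P_minus_def using that subspace_H2 subspace_conj_H2_0 cinner_zero_commute
    by (intro conjI ortho_proj_eqI) (auto simp: conj_H2_0_eq_ortho ortho_complement_def)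
  have p: "P_plus f \<in> H2" "f - P_plus f \<in> conj_H2_0"
    unfolding P_plus_def conj_H2_0_eq_ortho by (intro ortho_proj subspace_H2 closed_H2)+
  from *[OF p] p show "P_plus f \<in> H2" "P_minus f \<in> conj_H2_0" "P_plus f + P_minus f = f"
    by simp_all
qed

section \<open>Shift invariant subspaces of the circle\<close>

lemma mult_powi_inverse:
  "mult_L2 (\<lambda>z. z powi 1) (mult_L2 (\<lambda>z. z powi (-1)) f) = f"
  "mult_L2 (\<lambda>z. z powi (-1)) (mult_L2 (\<lambda>z. z powi 1) f) = f"
  by (simp_all only: mult_powi_powi) (simp_all add: mult_L2_one)

text \<open>The shift is invertible on the circle; written as a preimage, the image inherits
  closedness and linearity.\<close>

lemma shift_image_eq: "mult_L2 (\<lambda>z. z) ` T = {f. mult_L2 (\<lambda>z. z powi (-1)) f \<in> T}"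
  unfolding mult_id_eq_powi using mult_powi_inverse
  by (auto intro!: image_eqI[where x = "mult_L2 (\<lambda>z. z powi (-1)) _"] simp del: power_int_1_right)

lemma shift_invariant_power:
  assumes "mult_L2 (\<lambda>z. z) ` T \<subseteq> T" "f \<in> T"
  shows "mult_L2 (\<lambda>z. z powi int n) f \<in> T"
proof (induction n)
  case (Suc n)
  have "mult_L2 (\<lambda>z. z powi int (Suc n)) f = mult_L2 (\<lambda>z. z powi 1) (mult_L2 (\<lambda>z. z powi int n) f)"
    by (simp only: mult_powi_powi of_nat_Suc)
  then show ?case using Suc assms(1) unfolding mult_id_eq_powi by auto
qed (use assms(2) in \<open>simp add: mult_L2_one\<close>)

text \<open>The indicator function is found as the projection \<open>p\<close> of the constant 1
  onto \<open>T\<close>: the residual \<open>1 - p\<close> is orthogonal to all shifts of each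
  \<open>f\<close> in \<open>T\<close>, so it vanishes wherever \<open>f\<close> does not.
  Conversely, the shifts of \<open>p\<close> stay in \<open>T\<close> and generate all functions
  supported on \<open>A\<close>.\<close>

theorem wiener_doubly_invariant:
  assumes T: "L2.subspace T" "closed T" and inv: "mult_L2 (\<lambda>z. z) ` T = T"
  shows "\<exists>A\<in>sets circle_measure. T = mult_L2 (indicator A) ` UNIV"
proof -
  have inv': "mult_L2 (\<lambda>z. z powi n) f \<in> T" if "f \<in> T" for n f
  proof (cases n rule: int_cases2)
    case (nonneg k)
    then show ?thesis using shift_invariant_power[of T f k] inv that by simp
  next
    case (nonpos k)
    have "mult_L2 (\<lambda>z. z powi (- int k)) f \<in> T"
    proof (induction k)
      case (Suc k)
      have "mult_L2 (\<lambda>z. z powi (- int (Suc k))) f = mult_L2 (\<lambda>z. z powi (-1)) (mult_L2 (\<lambda>z. z powi (- int k)) f)"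
        by (simp only: mult_powi_powi) simp
      then show ?case using Suc inv shift_image_eq[of T] by auto
    qed (use that in \<open>simp add: mult_L2_one\<close>)
    with nonpos show ?thesis by simp
  qed
  define p where "p = ortho_proj T (zpow 0)"
  define q where "q = zpow 0 - p"
  have p: "p \<in> T" and q: "q \<in> ortho_complement T"
    unfolding p_def q_def by (rule ortho_proj[OF T])+
  have q_rep: "AE z in circle_measure. rep_L2 q z = 1 - rep_L2 p z"
    using rep_diff[of "zpow 0" p] rep_zpow[of 0] unfolding q_def by eventually_elim simp
  have q_orth: "AE z in circle_measure. (1 - rep_L2 p z) * cnj (rep_L2 f z) = 0" if "f \<in> T" for f
  proof -
    have "AE z in circle_measure. rep_L2 q z * cnj (rep_L2 f z) = 0"
      using q inv'[OF that]
      by (intro shift_orthogonal_imp_AE_zero) (simp add: cinner_powi_left ortho_complement_def)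
    then show ?thesis using q_rep by eventually_elim simp
  qed
  define A where "A = {z \<in> space circle_measure. rep_L2 p z = 1}"
  have A: "A \<in> sets circle_measure"
    unfolding A_def by measurable
  note A' = indicator_L_inf[OF A]
  \<comment> \<open>Taking \<open>f = p\<close> in \<open>q_orth\<close> gives
    \<open>(1 - p) * cnj p = 0\<close>, so almost everywhere \<open>p\<close> is either 1 or
    0.\<close>
  have p_rep: "AE z in circle_measure. rep_L2 p z = indicator A z"
    using q_orth[OF p] AE_space by eventually_elim (auto simp: A_def split: split_indicator)
  have ind: "mult_L2 (indicator A) (zpow 0) = p"
  proof (rule L2_eqI)
    show "AE z in circle_measure. rep_L2 (mult_L2 (indicator A) (zpow 0)) z = rep_L2 p z"
      using rep_mult[OF A', of "zpow 0"] rep_zpow[of 0] p_rep by eventually_elim simp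
  qed
  have "T = mult_L2 (indicator A) ` UNIV"
  proof (intro equalityI subsetI)
    fix f assume f: "f \<in> T"
    have "f = mult_L2 (indicator A) f"
    proof (rule L2_eqI)
      show "AE z in circle_measure. rep_L2 f z = rep_L2 (mult_L2 (indicator A) f) z"
        using rep_mult[OF A', of f] p_rep q_orth[OF f] by eventually_elim auto
    qed
    then show "f \<in> mult_L2 (indicator A) ` UNIV" by blast
  next
    fix f assume "f \<in> mult_L2 (indicator A) ` UNIV"
    then obtain g where g: "f = mult_L2 (indicator A) g" by blast
    have "g \<in> {g. mult_L2 (indicator A) g \<in> T}"
    proof (rule trig_dense[OF subspace_vimage_mult_L2[OF T(1)] closed_vimage_mult_L2[OF T(2) A']])
      show "zpow n \<in> {g. mult_L2 (indicator A) g \<in> T}" for n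
        using mult_zpow[OF A', of n] ind inv'[OF p] by simp
    qed
    with g show "f \<in> T" by simp
  qed
  with A show ?thesis by blast
qed

text \<open>A unit vector \<open>v\<close> of \<open>T\<close> orthogonal to \<open>z T\<close> is
  wandering: its shifts are orthonormal, so \<open>w * cnj w\<close> has the Fourier coefficients of
  the constant 1. Its forward shifts span \<open>w H2\<close> inside \<open>T\<close>, and its
  orthogonality to \<open>z T\<close> gives the reverse inclusion.\<close>

theorem helson_simply_invariant:
  assumes T: "L2.subspace T" "closed T" and inv: "mult_L2 (\<lambda>z. z) ` T \<subseteq> T"
    and ne: "mult_L2 (\<lambda>z. z) ` T \<noteq> T"
  shows "\<exists>w\<in>L_inf. (AE z in circle_measure. cmod (w z) = 1) \<and> T = mult_L2 w ` H2"
proof -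
  interpret prob_space circle_measure by (rule prob_space_circle_measure)
  define T' where "T' = mult_L2 (\<lambda>z. z) ` T"
  have T': "L2.subspace T'" "closed T'"
    unfolding T'_def shift_image_eq
    by (intro subspace_vimage_mult_L2 closed_vimage_mult_L2 T powi_L_inf)+
  obtain x where x: "x \<in> T" "x \<notin> T'" using inv ne by (auto simp: T'_def)
  define v0 where "v0 = x - ortho_proj T' x"
  note px = ortho_proj[OF T', of x]
  have v0: "v0 \<in> T" "v0 \<in> ortho_complement T'" "v0 \<noteq> 0"
    using px x inv L2.subspace_diff[OF T(1) x(1), of "ortho_proj T' x"]
    by (auto simp: v0_def T'_def[symmetric])
  define v where "v = (1 / norm v0) *\<^sub>R v0"
  have v: "v \<in> T" "v \<in> ortho_complement T'"
    unfolding v_def scaleR_L2_def using v0 by (auto intro!: L2.subspace_scale T subspace_ortho_complement)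
  have "norm v = 1"
    using v0(3) by (simp add: v_def)
  then have vv: "cinner v v = 1"
    using cinner_self(1)[of v] by (simp add: norm_L2_def inner_L2_def)
  have pos: "mult_L2 (\<lambda>z. z powi n) f \<in> T'" if "n > 0" "f \<in> T" for n f
  proof -
    define k where "k = nat (n - 1)"
    have k: "n = 1 + int k" using that by (simp add: k_def)
    have "mult_L2 (\<lambda>z. z powi n) f = mult_L2 (\<lambda>z. z powi 1) (mult_L2 (\<lambda>z. z powi int k) f)"
      by (simp only: mult_powi_powi k)
    then show ?thesis
      unfolding T'_def mult_id_eq_powi using shift_invariant_power[OF inv that(2)] by blast
  qed
  have orth: "cinner (mult_L2 (\<lambda>z. z powi n) v) v = (if n = 0 then 1 else 0)" for n
  proof -
    consider "n = 0" | "n > 0" | "- n > 0" by linarith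
    then show ?thesis
    proof cases
      case 2
      then show ?thesis using pos[OF 2 v(1)] v(2) by (simp add: ortho_complement_def cinner_zero_commute[of "mult_L2 _ _" v])
    next
      case 3
      then show ?thesis using pos[OF 3 v(1)] v(2) by (simp add: ortho_complement_def cinner_powi_left)
    qed (simp add: vv mult_L2_one)
  qed
  define w where "w = rep_L2 v"
  have w_int: "integrable circle_measure (\<lambda>z. w z * cnj (w z))"
    unfolding w_def by (intro integrable_mult_cnj square_integrable_rep)
  have "AE z in circle_measure. w z * cnj (w z) - 1 = 0"
  proof (rule fourier_zero_imp_AE_zero)
    show "integrable circle_measure (\<lambda>z. w z * cnj (w z) - 1)"
      using w_int by simp
    fix n
    note [measurable] = power_int_borel_measurable
    have i: "integrable circle_measure (\<lambda>z. w z * cnj (w z) * z powi n)"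
      by (rule integrable_mult_bounded[OF w_int, where C = 1]) (auto simp: norm_power_int)
    have i': "integrable circle_measure (\<lambda>z. z powi n)"
      by (rule integrable_const_bound[where B = 1])
        (auto simp: norm_power_int power_int_borel_measurable intro!: AE_in_circle)
    have "(LINT z|circle_measure. w z * cnj (w z) * z powi n) = cinner (mult_L2 (\<lambda>z. z powi n) v) v"
      unfolding cinner_rep
    proof (rule integral_cong_AE)
      show "AE z in circle_measure. w z * cnj (w z) * z powi n =
          rep_L2 (mult_L2 (\<lambda>z. z powi n) v) z * cnj (rep_L2 v z)"
        using rep_mult[OF powi_L_inf, of n v] by eventually_elim (simp add: w_def)
    qed (auto simp: w_def)
    then have "(LINT z|circle_measure. w z * cnj (w z) * z powi n - z powi n) = 0"
      using i i' orth[of n] integral_circle_powi[of n] by simp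
    then show "(LINT z|circle_measure. (w z * cnj (w z) - 1) * z powi n) = 0"
      by (simp add: left_diff_distrib)
  qed
  then have w1: "AE z in circle_measure. cmod (w z) = 1"
  proof eventually_elim
    case (elim z)
    then have "complex_of_real ((cmod (w z))\<^sup>2) = 1"
      by (simp only: complex_norm_square) simp
    then show ?case
      using norm_ge_zero[of "w z"] unfolding of_real_eq_1_iff power2_eq_1_iff by linarith
  qed
  have w: "w \<in> L_inf" using w1 by (intro L_inf_unimodular) (auto simp: w_def)
  have wv: "mult_L2 w (zpow 0) = v"
  proof (rule L2_eqI)
    show "AE z in circle_measure. rep_L2 (mult_L2 w (zpow 0)) z = rep_L2 v z"
      using rep_mult[OF w, of "zpow 0"] rep_zpow[of 0] by eventually_elim (simp add: w_def)
  qed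
  have "T = mult_L2 w ` H2"
  proof (intro equalityI subsetI)
    fix f assume f: "f \<in> T"
    define h where "h = mult_L2 (\<lambda>z. cnj (w z)) f"
    \<comment> \<open>Up to adjoints, a negative coefficient of \<open>cnj w * f\<close> pairs
      \<open>z powi (- n) * f\<close>, which lies in \<open>T'\<close>, with
      \<open>v\<close>.\<close>
    have "fourier_coeff h n = 0" if "n < 0" for n
    proof -
      have "fourier_coeff h n = cinner f (mult_L2 w (zpow n))"
        using cinner_mult_left[OF L_inf_cnj[OF w], of f "zpow n"]
        by (simp add: fourier_coeff_eq_cinner h_def)
      also have "\<dots> = cinner (mult_L2 (\<lambda>z. z powi (- n)) f) v"
        unfolding mult_zpow[OF w, of n] wv cinner_powi_left minus_minus ..
      also have "\<dots> = 0"
      proof -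
        have "mult_L2 (\<lambda>z. z powi (- n)) f \<in> T'"
          by (rule pos[OF _ f]) (use that in simp)
        then have "cinner v (mult_L2 (\<lambda>z. z powi (- n)) f) = 0"
          using v(2) unfolding ortho_complement_def by blast
        then show ?thesis by (rule cinner_zero_commute[THEN iffD1])
      qed
      finally show ?thesis .
    qed
    then have "h \<in> H2" by (simp add: H2_def)
    moreover have "f = mult_L2 w h"
      unfolding h_def by (rule mult_L2_cnj_unimodular(2)[OF w w1, symmetric])
    ultimately show "f \<in> mult_L2 w ` H2" by blast
  next
    have "H2 \<subseteq> {h. mult_L2 w h \<in> T}"
    proof (rule H2_subset[OF subspace_vimage_mult_L2[OF T(1)] closed_vimage_mult_L2[OF T(2) w]])
      show "zpow n \<in> {h. mult_L2 w h \<in> T}" if "n \<ge> 0" for n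
        using mult_zpow[OF w, of n] wv shift_invariant_power[OF inv v(1), of "nat n"] that by simp
    qed
    then show "f \<in> T" if "f \<in> mult_L2 w ` H2" for f using that by blast
  qed
  with w w1 show ?thesis by blast
qed

section \<open>The intertwining operator\<close>

lemma P_diff: "P_plus (f - g) = P_plus f - P_plus g" "P_minus (f - g) = P_minus f - P_minus g"
proof -
  have "f - g = (P_plus f - P_plus g) + (P_minus f - P_minus g)"
    using P_split(3)[of f] P_split(3)[of g] by (metis add_diff_add)
  moreover have "P_plus f - P_plus g \<in> H2" "P_minus f - P_minus g \<in> conj_H2_0"
    by (intro L2.subspace_diff subspace_H2 subspace_conj_H2_0 P_split)+
  ultimately show "P_plus (f - g) = P_plus f - P_plus g" "P_minus (f - g) = P_minus f - P_minus g"
    using P_decompI by metis+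
qed

lemma P_cscale: "P_plus (cscale c f) = cscale c (P_plus f)" "P_minus (cscale c f) = cscale c (P_minus f)"
proof -
  have "cscale c f = cscale c (P_plus f) + cscale c (P_minus f)"
    by (simp add: P_split(3) flip: L2.scale_right_distrib)
  moreover have "cscale c (P_plus f) \<in> H2" "cscale c (P_minus f) \<in> conj_H2_0"
    by (intro L2.subspace_scale subspace_H2 subspace_conj_H2_0 P_split)+
  ultimately show "P_plus (cscale c f) = cscale c (P_plus f)" "P_minus (cscale c f) = cscale c (P_minus f)"
    using P_decompI by metis+
qed

lemma norm_P: "norm (P_plus f) \<le> norm f" "norm (P_minus f) \<le> norm f"
proof -
  have "cinner (P_minus f) (P_plus f) = 0"
    using P_split(1,2)[of f] by (auto simp: conj_H2_0_eq_ortho ortho_complement_def)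
  then have "inner (P_plus f) (P_minus f) = 0"
    by (simp add: inner_L2_def cinner_zero_commute[of "P_minus f"])
  then have "(norm f)\<^sup>2 = (norm (P_plus f))\<^sup>2 + (norm (P_minus f))\<^sup>2"
    by (subst P_split(3)[symmetric, of f])
      (simp add: power2_norm_eq_inner inner_add_left inner_add_right inner_commute[of "P_minus f" "P_plus f"])
  then show "norm (P_plus f) \<le> norm f" "norm (P_minus f) \<le> norm f"
    by (auto intro: power2_le_imp_le)
qed

section \<open>Mapping properties of the operator for a fixed inner function\<close>

context
  fixes u :: "complex \<Rightarrow> complex"
  assumes u: "inner_function u" and u0: "u 0 \<noteq> 0"
begin

lemma boundary_unimodular: "AE z in circle_measure. cmod (boundary u z) = 1"
  using boundary_radial_limit[OF u] by eventually_elim simp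

lemma boundary_L_inf: "boundary u \<in> L_inf"
  using u by (intro L_inf_unimodular boundary_measurable boundary_unimodular) (simp add: inner_function_def)

text \<open>The assumption makes the exponent \<open>m - n\<close> non-negative, the range in which
  the moments are known.\<close>

lemma cinner_boundary_zpow:
  assumes "m \<ge> n"
  shows "cinner (mult_L2 (boundary u) (zpow m)) (zpow n) = (if m = n then u 0 else 0)"
proof -
  obtain k where k: "m - n = int k" using assms zero_le_imp_eq_int[of "m - n"] by auto
  then show ?thesis
    using boundary_moments[OF u, of k] by (simp add: cinner_mult_zpow[OF boundary_L_inf])
qed

lemma boundary_mult_H2:
  assumes "h \<in> H2"
  shows "mult_L2 (boundary u) h \<in> H2"
proof -
  have "H2 \<subseteq> {h. mult_L2 (boundary u) h \<in> H2}"
    by (rule H2_subset[OF subspace_vimage_mult_L2[OF subspace_H2]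
          closed_vimage_mult_L2[OF closed_H2 boundary_L_inf]])
      (auto simp: H2_def fourier_coeff_eq_cinner cinner_boundary_zpow)
  with assms show ?thesis by blast
qed

text \<open>The reproducing kernel of the model space at \<open>0\<close>.\<close>

lemma model_kernel:
  "zpow 0 - cscale (cnj (u 0)) (mult_L2 (boundary u) (zpow 0)) \<in> model_space u" (is "?k \<in> _")
proof -
  have "?k \<in> H2"
    by (intro L2.subspace_diff L2.subspace_scale subspace_H2 boundary_mult_H2 zpow_in_H2) auto
  \<comment> \<open>Against \<open>u * z ^ n\<close> both terms of the kernel contribute
    \<open>u 0\<close> if \<open>n = 0\<close> and 0 otherwise, the second because multiplication by
    \<open>u\<close> is isometric; they cancel.\<close>
  moreover have "H2 \<subseteq> {h. mult_L2 (boundary u) h \<in> ortho_complement {?k}}"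
  proof (rule H2_subset[OF subspace_vimage_mult_L2[OF subspace_ortho_complement]
          closed_vimage_mult_L2[OF closed_ortho_complement boundary_L_inf]])
    fix n :: int assume n: "n \<ge> 0"
    have "cinner (mult_L2 (boundary u) (zpow n)) (mult_L2 (boundary u) (zpow 0)) = cinner (zpow n) (zpow 0)"
      using cinner_mult_left[OF boundary_L_inf, of "zpow n" "mult_L2 (boundary u) (zpow 0)"]
      by (simp add: mult_L2_cnj_unimodular[OF boundary_L_inf boundary_unimodular])
    also have "\<dots> = (if n = 0 then 1 else 0)"
      using fourier_coeff_zpow[of n 0] by (simp add: fourier_coeff_eq_cinner)
    finally show "zpow n \<in> {h. mult_L2 (boundary u) h \<in> ortho_complement {?k}}"
      using n by (simp add: ortho_complement_def cinner_diff_right cinner_scale_right cinner_boundary_zpow)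
  qed
  ultimately show ?thesis
    unfolding model_space_def ortho_complement_def using cinner_zero_commute by fastforce
qed

lemma subspace_model_space: "L2.subspace (model_space u)"
  unfolding model_space_def by (intro L2.subspace_inter subspace_H2 subspace_ortho_complement)

lemma wave_op_in: "wave_op u g \<in> ortho_complement (model_space u)"
  unfolding wave_op_def
proof (rule L2.subspace_add[OF subspace_ortho_complement])
  show "P_minus g \<in> ortho_complement (model_space u)"
    using P_split(2)[of g] by (auto simp: conj_H2_0_eq_ortho ortho_complement_def model_space_def)
  have "cscale (cnj (u 0)) (P_plus g) \<in> H2"
    by (intro L2.subspace_scale subspace_H2 P_split)
  then show "mult_L2 (boundary u) (cscale (cnj (u 0)) (P_plus g)) \<in> ortho_complement (model_space u)"
    by (auto simp: ortho_complement_def model_space_def cinner_zero_commute[of "mult_L2 (boundary u) _"])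
qed

lemma wave_op_diff: "wave_op u (f - g) = wave_op u f - wave_op u g"
  by (simp add: wave_op_def P_diff L2.scale_right_diff_distrib mult_L2_diff algebra_simps)

lemma wave_op_cscale: "wave_op u (cscale c f) = cscale c (wave_op u f)"
  by (simp add: wave_op_def P_cscale mult_L2_cscale L2.scale_right_distrib L2.scale_left_commute)

text \<open>Continuity makes the preimage of a closed \<open>S\<close> closed. The constant comes
  from both projections being contractions and \<open>u\<close> being unimodular.\<close>

lemma bounded_linear_wave_op: "bounded_linear (wave_op u)"
proof (rule bounded_linear_intro)
  have zero: "wave_op u 0 = 0" using wave_op_diff[of 0 0] by simp
  show "wave_op u (f + g) = wave_op u f + wave_op u g" for f g
    using wave_op_diff[of f "- g"] wave_op_diff[of 0 g] zero by simp
  show "wave_op u (r *\<^sub>R f) = r *\<^sub>R wave_op u f" for r f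
    by (simp add: scaleR_L2_def wave_op_cscale)
  show "norm (wave_op u f) \<le> norm f * (1 + cmod (u 0))" for f
  proof -
    have s: "norm (cscale c g) = cmod c * norm g" for c g
    proof -
      have "cinner (cscale c g) (cscale c g) = of_real ((cmod c)\<^sup>2) * cinner g g"
        by (simp only: cinner_scale_left cinner_scale_right complex_norm_square) (simp add: mult_ac)
      then have "(norm (cscale c g))\<^sup>2 = (cmod c * norm g)\<^sup>2"
        by (simp add: power2_norm_eq_inner inner_L2_def power_mult_distrib del: of_real_power)
      then show ?thesis by (simp add: power2_eq_iff_nonneg)
    qed
    have "norm (mult_L2 (boundary u) (cscale (cnj (u 0)) (P_plus f))) \<le> 1 * norm (cscale (cnj (u 0)) (P_plus f))"
      using boundary_unimodular by (intro norm_mult_L2_le boundary_L_inf) (auto elim: eventually_mono)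
    also have "\<dots> \<le> cmod (u 0) * norm f"
      using norm_P(1)[of f] by (simp add: s mult_left_mono)
    finally have "norm (wave_op u f) \<le> norm f + cmod (u 0) * norm f"
      unfolding wave_op_def by (intro norm_triangle_le add_mono norm_P)
    then show ?thesis by (simp add: algebra_simps)
  qed
qed

text \<open>As \<open>u H2\<close> lies in \<open>H2\<close>, the two summands belong to orthogonal
  pieces and vanish separately; then \<open>u\<close> and \<open>cnj (u 0)\<close> are
  cancelled.\<close>

lemma inj_wave_op: "inj (wave_op u)"
proof (rule injI)
  fix f g assume "wave_op u f = wave_op u g"
  then have "wave_op u (f - g) = 0" by (simp add: wave_op_diff)
  moreover define h where "h = f - g"
  ultimately have h: "P_minus h + mult_L2 (boundary u) (cscale (cnj (u 0)) (P_plus h)) = 0"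
    by (simp add: wave_op_def)
  have "mult_L2 (boundary u) (cscale (cnj (u 0)) (P_plus h)) \<in> H2"
    by (intro boundary_mult_H2 L2.subspace_scale subspace_H2 P_split)
  from P_decompI[OF this P_split(2)] h P_decompI[OF L2.subspace_0[OF subspace_H2] L2.subspace_0[OF subspace_conj_H2_0]]
  have m: "P_minus h = 0" and "mult_L2 (boundary u) (cscale (cnj (u 0)) (P_plus h)) = 0"
    by (metis add.commute add.right_neutral)+
  then have "cscale (cnj (u 0)) (P_plus h) = 0"
    by (metis mult_L2_cnj_unimodular(1)[OF boundary_L_inf boundary_unimodular] mult_L2_zero)
  then have "P_plus h = 0" using u0 by (simp add: L2.scale_eq_0_iff)
  then show "f = g" using m P_split(3)[of h] by (simp add: h_def)
qed

lemma boundary_mult_H2_eq: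
  "mult_L2 (boundary u) ` H2 = {f. mult_L2 (\<lambda>z. cnj (boundary u z)) f \<in> H2}"
  using mult_L2_cnj_unimodular[OF boundary_L_inf boundary_unimodular]
  by (auto intro!: image_eqI[where x = "mult_L2 (\<lambda>z. cnj (boundary u z)) _"])

lemma closed_boundary_mult_H2: "closed (mult_L2 (boundary u) ` H2)"
  unfolding boundary_mult_H2_eq
  by (intro closed_vimage_mult_L2 closed_H2 L_inf_cnj boundary_L_inf)

lemma subspace_boundary_mult_H2: "L2.subspace (mult_L2 (boundary u) ` H2)"
  unfolding boundary_mult_H2_eq by (intro subspace_vimage_mult_L2 subspace_H2)

text \<open>For \<open>f\<close> orthogonal to the model space, the residual of
  \<open>P_plus f\<close> after projection onto \<open>u H2\<close> is both in the model space and
  orthogonal to it, hence 0. So \<open>P_plus f\<close> is in \<open>u H2\<close>, and dividing by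
  \<open>cnj (u 0)\<close> gives a preimage.\<close>

lemma range_wave_op: "range (wave_op u) = ortho_complement (model_space u)"
proof (intro equalityI subsetI)
  fix f assume f: "f \<in> ortho_complement (model_space u)"
  let ?M = "mult_L2 (boundary u) ` H2"
  define a where "a = ortho_proj ?M (P_plus f)"
  have a: "a \<in> ?M" "P_plus f - a \<in> ortho_complement ?M"
    unfolding a_def by (intro ortho_proj subspace_boundary_mult_H2 closed_boundary_mult_H2)+
  have "a \<in> H2" using a(1) boundary_mult_H2 by auto
  then have k: "P_plus f - a \<in> model_space u"
    unfolding model_space_def
    using a(2) L2.subspace_diff[OF subspace_H2 P_split(1)] by blast
  have "P_minus f \<in> ortho_complement (model_space u)"
    using P_split(2)[of f] by (auto simp: conj_H2_0_eq_ortho ortho_complement_def model_space_def)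
  moreover have "a \<in> ortho_complement (model_space u)"
    using a(1) by (auto simp: ortho_complement_def model_space_def cinner_zero_commute[of "mult_L2 (boundary u) _"])
  ultimately have "f - P_minus f - a \<in> ortho_complement (model_space u)"
    using f by (intro L2.subspace_diff subspace_ortho_complement)
  moreover have "f - P_minus f = P_plus f" using P_split(3)[of f] by (simp add: diff_eq_eq)
  ultimately have "P_plus f - a = 0" using k by (intro ortho_complement_disjoint[OF k]) simp
  then obtain h where h: "h \<in> H2" "P_plus f = mult_L2 (boundary u) h" using a(1) by auto
  have "P_plus (cscale (1 / cnj (u 0)) h + P_minus f) = cscale (1 / cnj (u 0)) h \<and>
      P_minus (cscale (1 / cnj (u 0)) h + P_minus f) = P_minus f"
    by (intro P_decompI L2.subspace_scale subspace_H2 h P_split)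
  then have "wave_op u (cscale (1 / cnj (u 0)) h + P_minus f) = f"
    using u0 h(2) P_split(3)[of f] by (simp add: wave_op_def add.commute)
  then show "f \<in> range (wave_op u)" by (metis rangeI)
qed (use wave_op_in in auto)

text \<open>\<open>z * W g\<close> and \<open>W (z * g)\<close> differ by a multiple of the kernel,
  which lies in the model space, while \<open>W (z * g)\<close> is orthogonal to it. Uniqueness
  identifies the difference with the projection that the dual shift subtracts.\<close>

lemma dual_shift_wave_op: "dual_shift u (wave_op u g) = wave_op u (mult_L2 (\<lambda>z. z) g)"
proof -
  define c where "c = fourier_coeff g (-1)"
  define d where "d = cnj (u 0)"
  define k where "k = zpow 0 - cscale d (mult_L2 (boundary u) (zpow 0))"
  \<comment> \<open>\<open>b\<close> and \<open>a\<close> are the two parts of \<open>z * g\<close>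
    after the constant \<open>c\<close> has changed sides.\<close>
  define b where "b = mult_L2 (\<lambda>z. z) (P_minus g) - cscale c (zpow 0)"
  define a where "a = mult_L2 (\<lambda>z. z) (P_plus g) + cscale c (zpow 0)"
  have gm: "fourier_coeff (P_minus g) (-1) = c"
    using P_split(1,3)[of g] fourier_coeff_add[of "P_plus g" "P_minus g" "-1"] by (simp add: c_def H2_def)
  have shift: "fourier_coeff (mult_L2 (\<lambda>z. z) f) n = fourier_coeff f (n - 1)" for f n
    unfolding mult_id_eq_powi by (rule fourier_coeff_shift)
  have "b \<in> conj_H2_0"
    using P_split(2)[of g] gm
    by (auto simp: b_def conj_H2_0_eq fourier_coeff_diff fourier_coeff_cscale fourier_coeff_zpow shift)
  moreover have "a \<in> H2"
    using P_split(1)[of g]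
    by (auto simp: a_def H2_def fourier_coeff_add fourier_coeff_cscale fourier_coeff_zpow shift)
  moreover have "a + b = mult_L2 (\<lambda>z. z) g"
    using P_split(3)[of g] by (simp add: a_def b_def flip: mult_L2_add)
  ultimately have ab: "P_plus (mult_L2 (\<lambda>z. z) g) = a" "P_minus (mult_L2 (\<lambda>z. z) g) = b"
    using P_decompI by metis+
  have "mult_L2 (\<lambda>z. z) (wave_op u g) - wave_op u (mult_L2 (\<lambda>z. z) g) = cscale c k"
    using mult_L2_commute[OF id_L_inf boundary_L_inf]
    by (simp add: wave_op_def ab a_def b_def k_def d_def mult_L2_add mult_L2_cscale
        L2.scale_right_distrib L2.scale_right_diff_distrib L2.scale_left_commute algebra_simps)
  moreover have "cscale c k \<in> model_space u"
    unfolding k_def d_def by (intro L2.subspace_scale subspace_model_space model_kernel)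
  ultimately have "ortho_proj (model_space u) (mult_L2 (\<lambda>z. z) (wave_op u g)) = cscale c k"
    using wave_op_in[of "mult_L2 (\<lambda>z. z) g"]
    by (intro ortho_proj_eqI subspace_model_space) (auto simp: algebra_simps diff_eq_eq)
  with \<open>mult_L2 (\<lambda>z. z) (wave_op u g) - wave_op u (mult_L2 (\<lambda>z. z) g) = cscale c k\<close>
  show ?thesis unfolding dual_shift_def by (simp add: algebra_simps)
qed

end

theorem theorem6p1:
  fixes u :: "complex \<Rightarrow> complex" and S :: "L2 set"
  assumes "inner_function u"
    and "u 0 \<noteq> 0"
    and "L2.subspace S"
    and "closed S"
    and "S \<subseteq> ortho_complement (model_space u)"
    and "dual_shift u ` S \<subseteq> S"
  shows "(dual_shift u ` S = S \<longrightarrow>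
           (\<exists>A\<in>sets circle_measure. S = wave_op u ` mult_L2 (indicator A) ` UNIV)) \<and>
         (dual_shift u ` S \<noteq> S \<longrightarrow>
           (\<exists>w\<in>L_inf. (AE z in circle_measure. cmod (w z) = 1) \<and>
              S = wave_op u ` mult_L2 w ` H2))"
proof -
  note u = assms(1,2)
  define T where "T = wave_op u -` S"
  have S: "S = wave_op u ` T"
    using assms(5) range_wave_op[OF u] unfolding T_def by auto
  have D: "dual_shift u ` S = wave_op u ` (mult_L2 (\<lambda>z. z) ` T)"
    by (simp add: S image_image dual_shift_wave_op[OF u])
  have T: "L2.subspace T" "closed T"
  proof -
    have "wave_op u 0 = 0" and "wave_op u (f + g) = wave_op u f + wave_op u g" for f g
      using bounded_linear_wave_op[OF u] by (simp_all add: linear_simps)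
    then show "L2.subspace T"
      using assms(3) by (auto simp: T_def L2.subspace_def wave_op_cscale[OF u])
    show "closed T"
      unfolding T_def by (intro closed_vimage assms(4) linear_continuous_on bounded_linear_wave_op u)
  qed
  have inv: "mult_L2 (\<lambda>z. z) ` T \<subseteq> T"
    using assms(6) by (auto simp: T_def simp flip: dual_shift_wave_op[OF u])
  \<comment> \<open>Injectivity transfers the dichotomy from \<open>S\<close> to \<open>T\<close>;
    an arbitrary intertwiner could turn distinct sets into equal images.\<close>
  have eq: "dual_shift u ` S = S \<longleftrightarrow> mult_L2 (\<lambda>z. z) ` T = T"
    unfolding D by (subst S) (rule inj_image_eq_iff[OF inj_wave_op[OF u]])
  show ?thesis
    using wiener_doubly_invariant[OF T] helson_simply_invariant[OF T inv] S unfolding eq by metis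
qed

end
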